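(* Let $(\mathbb T^2,g)$ be a two-dimensional Riemannian torus with Gaussian curvature $K$ and the 1-pseudoform $\Lambda=(\Lambda_1,\Lambda_2)$ of weight 3 defined in the context. If the torus admits a real irreducible rank 3 Killing tensor field, then there exist a real constant pseudovector $c\neq0$ of weight 3 and a cohomology class $\sigma\in H^1(\mathbb T^2,\mathbb R)$ such that $$\oint_\gamma(c^1\Lambda_1+c^2\Lambda_2)\,dt=\langle\sigma,[\gamma]\rangle$$ for every closed curve $\gamma:[a,b]\to\mathbb T^2$ which is a part of an isoline $\{K=K_0\}$, contains no critical points of $K$, and is parameterized so that $\|\dot\gamma\|=\|\nabla K\|$. Here $[\gamma]\in H_1(\mathbb T^2,\mathbb R)$ is the homology class of $\gamma$ and $\langle\cdot,\cdot\rangle$ is the canonical pairing of de Rham cohomology and homology.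
   Context: Killing tensor field: symmetric tensor field $f$ with $\sigma\nabla f=0$; irreducible (rank 3): not a finite sum of symmetric products of Killing fields of positive ranks. Global isothermal coordinates: $\mathbb T^2=\mathbb R^2/\Gamma$, $\Gamma$ a lattice, $g=e^{2\mu}(dx^2+dy^2)=\lambda|dz|^2$, $\mu$ smooth $\Gamma$-periodic; unique up to $z=az'+b$ for a fixed orientation. A pseudovector of weight $k$: to each such system a pair $(c^1,c^2)$ with $c^1+ic^2=a^k(c'^1+ic'^2)$, $c^1-ic^2=\bar a^k(c'^1-ic'^2)$ under $z=az'$; a 1-pseudoform of weight $k$: pairs $(\omega_1,\omega_2)$ with $\omega_1+i\omega_2=\bar a^{-k}(\omega'_1+i\omega'_2)$, $\omega_1-i\omega_2=a^{-k}(\omega'_1-i\omega'_2)$. $\Lambda$ is given in global isothermal coordinates by $\Lambda_1=\mu_{xxx}-3\mu_{xyy}+10\mu_x\mu_{xx}-20\mu_y\mu_{xy}-10\mu_x\mu_{yy}+8\mu_x^3-24\mu_x\mu_y^2$, $\Lambda_2=3\mu_{xxy}-\mu_{yyy}+10\mu_y\mu_{xx}+20\mu_x\mu_{xy}-10\mu_y\mu_{yy}+24\mu_x^2\mu_y-8\mu_y^3$.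
   Formalization: The closed curve γ is in addition assumed to be oriented so that (∇K, γ̇) is a positively oriented pair; the English leaves the direction of γ open, although reversing γ preserves the integral and changes the sign of ⟨σ,[γ]⟩. *)

theory Defs
  imports "HOL-Analysis.Analysis"
begin

text \<open>Global isothermal coordinates: the torus is \<open>\<complex>/\<Gamma>\<close>, \<open>\<Gamma> = \<int>\<omega>1 + \<int>\<omega>2\<close>,
  metric \<open>g = e^(2\<mu>)(dx^2+dy^2)\<close>, point \<open>z = x + i y\<close>.
  Coordinate index 0 = x, 1 = y.  Tensor fields are given by their covariant
  components (index lists) as functions on the universal cover \<open>\<complex>\<close>.\<close>

type_synonym tfield = "nat list \<Rightarrow> complex \<Rightarrow> real"

definition lattice :: "complex \<Rightarrow> complex \<Rightarrow> complex set" where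
  "lattice \<omega>1 \<omega>2 = {of_int m * \<omega>1 + of_int n * \<omega>2 | m n. True}"

definition is_lattice_basis :: "complex \<Rightarrow> complex \<Rightarrow> bool" where
  "is_lattice_basis \<omega>1 \<omega>2 \<longleftrightarrow> Im (cnj \<omega>1 * \<omega>2) \<noteq> 0"

definition periodic :: "complex \<Rightarrow> complex \<Rightarrow> (complex \<Rightarrow> real) \<Rightarrow> bool" where
  "periodic \<omega>1 \<omega>2 f \<longleftrightarrow> (\<forall>z. f (z + \<omega>1) = f z \<and> f (z + \<omega>2) = f z)"

definition pd :: "nat \<Rightarrow> (complex \<Rightarrow> real) \<Rightarrow> complex \<Rightarrow> real" where
  "pd i f z = (if i = 0 then deriv (\<lambda>t. f (Complex t (Im z))) (Re z)
               else deriv (\<lambda>t. f (Complex (Re z) t)) (Im z))"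

definition partial_differentiable :: "nat \<Rightarrow> (complex \<Rightarrow> real) \<Rightarrow> complex \<Rightarrow> bool" where
  "partial_differentiable i f z \<longleftrightarrow>
     (if i = 0 then (\<lambda>t. f (Complex t (Im z))) differentiable (at (Re z))
      else (\<lambda>t. f (Complex (Re z) t)) differentiable (at (Im z)))"

definition smooth2 :: "(complex \<Rightarrow> real) \<Rightarrow> bool" where
  "smooth2 f \<longleftrightarrow> (\<forall>ds. set ds \<subseteq> {0,1} \<longrightarrow>
      continuous_on UNIV (foldr pd ds f) \<and>
      (\<forall>i\<in>{0,1}. \<forall>z. partial_differentiable i (foldr pd ds f) z))"

definition idx_lists :: "nat \<Rightarrow> nat list set" where
  "idx_lists m = {is. length is = m \<and> set is \<subseteq> {0,1}}"

definition permute_list_by :: "(nat \<Rightarrow> nat) \<Rightarrow> nat list \<Rightarrow> nat list" where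
  "permute_list_by \<pi> is = map (\<lambda>k. is ! \<pi> k) [0..<length is]"

definition sym_tensor_field :: "complex \<Rightarrow> complex \<Rightarrow> nat \<Rightarrow> tfield \<Rightarrow> bool" where
  "sym_tensor_field \<omega>1 \<omega>2 m T \<longleftrightarrow>
     (\<forall>is\<in>idx_lists m. smooth2 (T is) \<and> periodic \<omega>1 \<omega>2 (T is) \<and>
        (\<forall>\<pi>. \<pi> permutes {..<m} \<longrightarrow> T (permute_list_by \<pi> is) = T is))"

text \<open>Christoffel symbols \<open>\<Gamma>^k_ij\<close> of \<open>e^(2\<mu>)(dx^2+dy^2)\<close>.\<close>
definition christoffel :: "(complex \<Rightarrow> real) \<Rightarrow> nat \<Rightarrow> nat \<Rightarrow> nat \<Rightarrow> complex \<Rightarrow> real" where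
  "christoffel \<mu> k i j z =
     (if k = i then pd j \<mu> z else 0) + (if k = j then pd i \<mu> z else 0)
     - (if i = j then pd k \<mu> z else 0)"

definition cov_deriv :: "(complex \<Rightarrow> real) \<Rightarrow> tfield \<Rightarrow> tfield" where
  "cov_deriv \<mu> T lis z = (case lis of [] \<Rightarrow> 0 | l # is \<Rightarrow>
      pd l (T is) z
      - (\<Sum>a<length is. \<Sum>p<2. christoffel \<mu> p l (is ! a) z * T (is[a := p]) z))"

definition killing :: "complex \<Rightarrow> complex \<Rightarrow> (complex \<Rightarrow> real) \<Rightarrow> nat \<Rightarrow> tfield \<Rightarrow> bool" where
  "killing \<omega>1 \<omega>2 \<mu> m T \<longleftrightarrow> sym_tensor_field \<omega>1 \<omega>2 m T \<and>
     (\<forall>is\<in>idx_lists (Suc m). \<forall>z.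
        (\<Sum>\<pi>\<in>{\<pi>. \<pi> permutes {..<Suc m}}. cov_deriv \<mu> T (permute_list_by \<pi> is) z) = 0)"

definition symprod :: "nat \<Rightarrow> tfield \<Rightarrow> nat \<Rightarrow> tfield \<Rightarrow> tfield" where
  "symprod p A q B is z = (1 / fact (p + q)) *
     (\<Sum>\<pi>\<in>{\<pi>. \<pi> permutes {..<p+q}}.
        A (map (\<lambda>k. is ! \<pi> k) [0..<p]) z * B (map (\<lambda>k. is ! \<pi> k) [p..<p+q]) z)"

fun symprod_list :: "(nat \<times> tfield) list \<Rightarrow> tfield" where
  "symprod_list [] = (\<lambda>is z. 1)"
| "symprod_list ((p, A) # rest) = symprod p A (sum_list (map fst rest)) (symprod_list rest)"

definition reducible_killing :: "complex \<Rightarrow> complex \<Rightarrow> (complex \<Rightarrow> real) \<Rightarrow> nat \<Rightarrow> tfield \<Rightarrow> bool" where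
  "reducible_killing \<omega>1 \<omega>2 \<mu> m f \<longleftrightarrow>
     (\<exists>N (F :: nat \<Rightarrow> (nat \<times> tfield) list).
        (\<forall>i<N. length (F i) \<ge> 2 \<and> sum_list (map fst (F i)) = m \<and>
               (\<forall>(p, A)\<in>set (F i). 0 < p \<and> killing \<omega>1 \<omega>2 \<mu> p A)) \<and>
        (\<forall>is\<in>idx_lists m. \<forall>z. f is z = (\<Sum>i<N. symprod_list (F i) is z)))"

definition irreducible_killing :: "complex \<Rightarrow> complex \<Rightarrow> (complex \<Rightarrow> real) \<Rightarrow> nat \<Rightarrow> tfield \<Rightarrow> bool" where
  "irreducible_killing \<omega>1 \<omega>2 \<mu> m f \<longleftrightarrow>
     killing \<omega>1 \<omega>2 \<mu> m f \<and> \<not> reducible_killing \<omega>1 \<omega>2 \<mu> m f"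

definition gauss_curv :: "(complex \<Rightarrow> real) \<Rightarrow> complex \<Rightarrow> real" where
  "gauss_curv \<mu> z = - exp (-2 * \<mu> z) * (pd 0 (pd 0 \<mu>) z + pd 1 (pd 1 \<mu>) z)"

definition Lambda1 :: "(complex \<Rightarrow> real) \<Rightarrow> complex \<Rightarrow> real" where
  "Lambda1 \<mu> z =
     pd 0 (pd 0 (pd 0 \<mu>)) z - 3 * pd 0 (pd 1 (pd 1 \<mu>)) z
     + 10 * pd 0 \<mu> z * pd 0 (pd 0 \<mu>) z - 20 * pd 1 \<mu> z * pd 0 (pd 1 \<mu>) z
     - 10 * pd 0 \<mu> z * pd 1 (pd 1 \<mu>) z + 8 * (pd 0 \<mu> z) ^ 3
     - 24 * pd 0 \<mu> z * (pd 1 \<mu> z) ^ 2"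

definition Lambda2 :: "(complex \<Rightarrow> real) \<Rightarrow> complex \<Rightarrow> real" where
  "Lambda2 \<mu> z =
     3 * pd 0 (pd 0 (pd 1 \<mu>)) z - pd 1 (pd 1 (pd 1 \<mu>)) z
     + 10 * pd 1 \<mu> z * pd 0 (pd 0 \<mu>) z + 20 * pd 0 \<mu> z * pd 0 (pd 1 \<mu>) z
     - 10 * pd 1 \<mu> z * pd 1 (pd 1 \<mu>) z + 24 * (pd 0 \<mu> z) ^ 2 * pd 1 \<mu> z
     - 8 * (pd 1 \<mu> z) ^ 3"

end

theory Submission
  imports Defs "HOL-Complex_Analysis.Cauchy_Integral_Formula"
begin

text \<open>Write a rank 3 field in contravariant complex components as
  \<open>a p\<^sup>3 + b p\<^sup>2 \<bar>p\<close> plus conjugates, put \<open>\<lambda> = e\<^sup>2\<^sup>\<mu>\<close> and let \<open>u = u\<^sub>1 + i u\<^sub>2\<close> be a real multiple of \<open>\<lambda> b\<close>.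
  The Killing equation says that \<open>a\<close> is holomorphic, hence constant by Liouville's theorem, that the
  antiholomorphic derivative of \<open>u\<close> is \<open>-a \<lambda>\<^sub>z\<close>, and that \<open>\<lambda> u\<close> has divergence zero. If \<open>a = 0\<close> then \<open>u\<close> is a constant
  Killing vector field and the tensor is its product with the metric, so irreducibility gives \<open>a \<noteq> 0\<close>. Applying
  the Laplacian to the divergence equation eliminates the derivatives of \<open>u\<close> and leaves
  \<open>c\<^sup>1 \<Lambda>\<^sub>1 + c\<^sup>2 \<Lambda>\<^sub>2 = -(u\<^sub>1 K\<^sub>x + u\<^sub>2 K\<^sub>y)\<close> with \<open>c\<^sup>1 + i c\<^sup>2 = a\<close>. On an isoline traversed with
  \<open>\<gamma>' = \<lambda>\<^sup>-\<^sup>1 (-K\<^sub>y, K\<^sub>x)\<close> the integrand is therefore the pull-back of the closed periodic form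
  \<open>\<lambda> (u\<^sub>2 dx - u\<^sub>1 dy)\<close>.\<close>

subsection \<open>Calculus of smooth functions\<close>

text \<open>Coordinate indices stay literally 0 and 1, so that \<open>pd 1 f\<close> and
  \<open>T [0, 1, 1]\<close> keep the form in which the rules below mention them.\<close>

declare One_nat_def [simp del]

definition coord :: "nat \<Rightarrow> complex \<Rightarrow> real" where
  "coord i z = (if i = 0 then Re z else Im z)"

definition coord_line :: "nat \<Rightarrow> complex \<Rightarrow> real \<Rightarrow> complex" where
  "coord_line i z t = (if i = 0 then Complex t (Im z) else Complex (Re z) t)"

text \<open>\<open>pd\<close> rests on \<open>deriv\<close>, which has a value even where no
  derivative exists. The relation records existence and value together, so that derivative rules
  chain.\<close>

definition has_pd :: "nat \<Rightarrow> (complex \<Rightarrow> real) \<Rightarrow> real \<Rightarrow> complex \<Rightarrow> bool" where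
  "has_pd i f D z \<longleftrightarrow> ((\<lambda>t. f (coord_line i z t)) has_real_derivative D) (at (coord i z))"

lemma coord_line_coord [simp]: "coord_line i z (coord i z) = z"
  by (simp add: coord_line_def coord_def)

lemma has_pd_imp:
  assumes "has_pd i f D z"
  shows "pd i f z = D" "partial_differentiable i f z"
  using assms
  by (auto simp: has_pd_def coord_line_def coord_def pd_def partial_differentiable_def
      real_differentiable_def intro: DERIV_imp_deriv split: if_splits)

lemma partial_differentiable_iff_has_pd: "partial_differentiable i f z \<longleftrightarrow> has_pd i f (pd i f z) z"
proof
  assume "partial_differentiable i f z"
  then obtain D where "has_pd i f D z"
    by (auto simp: has_pd_def coord_line_def coord_def partial_differentiable_def
        real_differentiable_def split: if_splits)
  then show "has_pd i f (pd i f z) z"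
    using has_pd_imp(1) by metis
qed (rule has_pd_imp)

lemma has_pd_const: "has_pd i (\<lambda>z. c) 0 z"
  by (simp add: has_pd_def)

lemma has_pd_add:
  "has_pd i f A z \<Longrightarrow> has_pd i g B z \<Longrightarrow> has_pd i (\<lambda>z. f z + g z) (A + B) z"
  unfolding has_pd_def by (rule DERIV_add)

lemma has_pd_mult:
  "has_pd i f A z \<Longrightarrow> has_pd i g B z \<Longrightarrow> has_pd i (\<lambda>z. f z * g z) (A * g z + f z * B) z"
  unfolding has_pd_def using DERIV_mult by (force simp: algebra_simps)

lemma has_pd_exp:
  "has_pd i f A z \<Longrightarrow> has_pd i (\<lambda>z. exp (f z)) (exp (f z) * A) z"
  unfolding has_pd_def using DERIV_fun_exp by fastforce

lemma smooth2_continuous: "smooth2 f \<Longrightarrow> continuous_on UNIV f"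
  unfolding smooth2_def by (drule spec[of _ "[]"]) simp

lemma smooth2_has_pd: "smooth2 f \<Longrightarrow> i \<in> {0, 1} \<Longrightarrow> has_pd i f (pd i f z) z"
  unfolding smooth2_def partial_differentiable_iff_has_pd[symmetric]
  by (drule spec[of _ "[]"]) auto

lemma smooth2_pd [simp]:
  assumes "smooth2 f" "i \<in> {0, 1}"
  shows "smooth2 (pd i f)"
  unfolding smooth2_def
proof (intro allI impI)
  fix ds :: "nat list"
  assume "set ds \<subseteq> {0, 1}"
  with assms have "set (ds @ [i]) \<subseteq> {0, 1}"
    by auto
  with assms show "continuous_on UNIV (foldr pd ds (pd i f)) \<and>
      (\<forall>j\<in>{0,1}. \<forall>z. partial_differentiable j (foldr pd ds (pd i f)) z)"
    unfolding smooth2_def by (metis (no_types, lifting) foldr.simps comp_id foldr_append comp_apply)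
qed

text \<open>\<open>smooth2\<close> quantifies over all iterated partial derivatives, where a direct
  proof for products would need a Leibniz formula. This class is closed under \<open>pd\<close>, so
  differentiating once is enough.\<close>

inductive smooth_closure :: "(complex \<Rightarrow> real) \<Rightarrow> bool" where
  base: "smooth2 f \<Longrightarrow> smooth_closure f"
| const: "smooth_closure (\<lambda>z. c)"
| add: "smooth_closure f \<Longrightarrow> smooth_closure g \<Longrightarrow> smooth_closure (\<lambda>z. f z + g z)"
| mult: "smooth_closure f \<Longrightarrow> smooth_closure g \<Longrightarrow> smooth_closure (\<lambda>z. f z * g z)"
| exp: "smooth_closure f \<Longrightarrow> smooth_closure (\<lambda>z. exp (f z))"

lemma smooth_closure_pd:
  assumes "smooth_closure f" "i \<in> {0, 1}"
  shows "continuous_on UNIV f \<and> (\<forall>z. has_pd i f (pd i f z) z) \<and> smooth_closure (pd i f)"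
  using assms
proof (induction rule: smooth_closure.induct)
  case (base f)
  then show ?case
    by (auto simp: smooth2_continuous smooth2_has_pd smooth_closure.base)
next
  case (const c)
  have "pd i (\<lambda>z. c) = (\<lambda>z. 0)"
    using has_pd_imp(1)[OF has_pd_const] by blast
  then show ?case
    by (simp add: has_pd_const smooth_closure.const)
next
  case (add f g)
  then have *: "has_pd i (\<lambda>z. f z + g z) (pd i f z + pd i g z) z" for z
    by (simp add: has_pd_add)
  then have "pd i (\<lambda>z. f z + g z) = (\<lambda>z. pd i f z + pd i g z)"
    using has_pd_imp(1) by blast
  then show ?case
    using add * by (auto intro: continuous_on_add smooth_closure.add)
next
  case (mult f g)
  then have *: "has_pd i (\<lambda>z. f z * g z) (pd i f z * g z + f z * pd i g z) z" for z
    by (simp add: has_pd_mult)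
  then have "pd i (\<lambda>z. f z * g z) = (\<lambda>z. pd i f z * g z + f z * pd i g z)"
    using has_pd_imp(1) by blast
  then show ?case
    using mult * by (auto intro!: continuous_on_mult smooth_closure.add smooth_closure.mult)
next
  case (exp f)
  then have *: "has_pd i (\<lambda>z. exp (f z)) (exp (f z) * pd i f z) z" for z
    by (simp add: has_pd_exp)
  then have "pd i (\<lambda>z. exp (f z)) = (\<lambda>z. exp (f z) * pd i f z)"
    using has_pd_imp(1) by blast
  then show ?case
    using exp * by (auto intro!: continuous_on_exp smooth_closure.exp smooth_closure.mult)
qed

lemma smooth_closure_imp_smooth2:
  assumes "smooth_closure f"
  shows "smooth2 f"
proof -
  have "smooth_closure (foldr pd ds f)" if "set ds \<subseteq> {0, 1}" for ds
    using that by (induction ds) (simp_all add: assms smooth_closure_pd)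
  then show ?thesis
    unfolding smooth2_def using smooth_closure_pd[of "foldr pd _ f"] has_pd_imp(2)
    by (metis insertI1)
qed

lemma smooth2_const [simp]: "smooth2 (\<lambda>z. c)"
  by (rule smooth_closure_imp_smooth2[OF smooth_closure.const])

lemma smooth2_add [simp]: "smooth2 f \<Longrightarrow> smooth2 g \<Longrightarrow> smooth2 (\<lambda>z. f z + g z)"
  by (rule smooth_closure_imp_smooth2) (simp add: smooth_closure.add smooth_closure.base)

lemma smooth2_mult [simp]: "smooth2 f \<Longrightarrow> smooth2 g \<Longrightarrow> smooth2 (\<lambda>z. f z * g z)"
  by (rule smooth_closure_imp_smooth2) (simp add: smooth_closure.mult smooth_closure.base)

lemma smooth2_exp [simp]: "smooth2 f \<Longrightarrow> smooth2 (\<lambda>z. exp (f z))"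
  by (rule smooth_closure_imp_smooth2) (simp add: smooth_closure.exp smooth_closure.base)

lemma smooth2_minus [simp]: "smooth2 f \<Longrightarrow> smooth2 (\<lambda>z. - f z)"
  using smooth2_mult[OF smooth2_const[of "-1"]] by simp

lemma smooth2_diff [simp]: "smooth2 f \<Longrightarrow> smooth2 g \<Longrightarrow> smooth2 (\<lambda>z. f z - g z)"
  using smooth2_add[OF _ smooth2_minus] by simp

lemma smooth2_power [simp]: "smooth2 f \<Longrightarrow> smooth2 (\<lambda>z. f z ^ n)"
  by (induction n) simp_all

lemma pd_const [simp]: "pd i (\<lambda>z. c) = (\<lambda>z. 0)"
  using has_pd_imp(1)[OF has_pd_const] by blast

lemma pd_add [simp]:
  assumes "smooth2 f" "smooth2 g" "i \<in> {0, 1}"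
  shows "pd i (\<lambda>z. f z + g z) = (\<lambda>z. pd i f z + pd i g z)"
  using assms has_pd_imp(1)[OF has_pd_add] smooth2_has_pd by blast

lemma pd_mult [simp]:
  assumes "smooth2 f" "smooth2 g" "i \<in> {0, 1}"
  shows "pd i (\<lambda>z. f z * g z) = (\<lambda>z. pd i f z * g z + f z * pd i g z)"
  using assms has_pd_imp(1)[OF has_pd_mult] smooth2_has_pd by blast

lemma pd_exp [simp]:
  assumes "smooth2 f" "i \<in> {0, 1}"
  shows "pd i (\<lambda>z. exp (f z)) = (\<lambda>z. exp (f z) * pd i f z)"
  using assms has_pd_imp(1)[OF has_pd_exp] smooth2_has_pd by blast

lemma pd_minus [simp]:
  assumes "smooth2 f" "i \<in> {0, 1}"
  shows "pd i (\<lambda>z. - f z) = (\<lambda>z. - pd i f z)"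
  using pd_mult[OF smooth2_const[of "-1"] assms] by simp

lemma pd_diff [simp]:
  assumes "smooth2 f" "smooth2 g" "i \<in> {0, 1}"
  shows "pd i (\<lambda>z. f z - g z) = (\<lambda>z. pd i f z - pd i g z)"
  using pd_add[OF assms(1) smooth2_minus[OF assms(2)] assms(3)] assms by simp


section \<open>Total derivatives, symmetry of second derivatives, potentials of closed forms\<close>

lemma has_derivative_of_partials:
  assumes P: "\<And>z. has_pd 0 f (P z) z" and Q: "\<And>z. has_pd 1 f (Q z) z"
    and cont: "continuous_on UNIV Q"
  shows "(f has_derivative (\<lambda>h. P z * Re h + Q z * Im h)) (at z)"
proof -
  have C: "continuous_on UNIV (\<lambda>p. Q (Complex (fst p) (snd p)))"
    by (rule continuous_on_compose2[OF cont]) (auto simp: Complex_eq intro!: continuous_intros)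
  have "((\<lambda>(x, y). f (Complex x y)) has_derivative (\<lambda>(tx, ty). P z * tx + blinfun_scaleR_left (Q z) ty))
      (at (Re z, Im z) within UNIV \<times> UNIV)"
  proof (rule has_derivative_partialsI[where fy = "\<lambda>x y. blinfun_scaleR_left (Q (Complex x y))"
        and x = "Re z" and y = "Im z", unfolded complex.collapse])
    show "((\<lambda>x. f (Complex x (Im z))) has_derivative (*) (P z)) (at (Re z) within UNIV)"
      using P[of z] by (simp add: has_pd_def coord_def coord_line_def has_field_derivative_def)
  next
    fix x y
    show "((\<lambda>y. f (Complex x y)) has_derivative
        blinfun_apply (blinfun_scaleR_left (Q (Complex x y)))) (at y within UNIV)"
      using Q[of "Complex x y"]
      by (auto simp: has_pd_def coord_def coord_line_def has_field_derivative_def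
          elim!: has_derivative_eq_rhs)
  next
    have "continuous_on UNIV (\<lambda>p. blinfun_scaleR_left (Q (Complex (fst p) (snd p))) :: real \<Rightarrow>\<^sub>L real)"
      by (intro continuous_intros C)
    then show "continuous (at (Re z, Im z) within UNIV \<times> UNIV)
        (\<lambda>(x, y). blinfun_scaleR_left (Q (Complex x y)) :: real \<Rightarrow>\<^sub>L real)"
      by (simp add: continuous_on_eq_continuous_within split_beta')
  qed auto
  then have *: "((\<lambda>p. f (Complex (fst p) (snd p))) has_derivative (\<lambda>p. P z * fst p + Q z * snd p))
      (at (Re z, Im z))"
    by (simp add: split_beta' mult.commute)
  have "((\<lambda>z. (Re z, Im z)) has_derivative (\<lambda>z. (Re z, Im z))) (at z)"
    by (auto intro!: derivative_eq_intros)
  from has_derivative_compose[OF this *] show ?thesis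
    by simp
qed

lemma has_derivative_imp_has_pd:
  assumes "(f has_derivative (\<lambda>h. A * Re h + B * Im h)) (at z)"
  shows "has_pd 0 f A z" "has_pd 1 f B z"
proof -
  have d: "(coord_line i z has_derivative (\<lambda>h. if i = 0 then of_real h else \<i> * of_real h)) (at (coord i z))" for i
    by (cases "i = 0") (auto simp: coord_line_def[abs_def] Complex_eq intro!: derivative_eq_intros)
  have "has_pd i f (if i = 0 then A else B) z" for i
    using has_derivative_compose[OF d[of i], of f "\<lambda>h. A * Re h + B * Im h"] assms
    by (auto simp: has_pd_def has_field_derivative_def elim!: has_derivative_eq_rhs)
  from this[of 0] this[of 1] show "has_pd 0 f A z" "has_pd 1 f B z"
    by simp_all
qed

lemma smooth2_has_derivative:
  "smooth2 f \<Longrightarrow> (f has_derivative (\<lambda>h. pd 0 f z * Re h + pd 1 f z * Im h)) (at z)"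
  by (rule has_derivative_of_partials) (simp_all add: smooth2_has_pd smooth2_continuous)

lemma smooth2_continuous_compose:
  "smooth2 f \<Longrightarrow> continuous_on S g \<Longrightarrow> continuous_on S (\<lambda>x. f (g x))"
  by (rule continuous_on_compose2[OF smooth2_continuous]) auto

text \<open>The increment of \<open>f\<close> from height \<open>c\<close> to height
  \<open>v\<close> is the integral of \<open>pd 1 f\<close>; differentiate it in \<open>x\<close>
  under the integral sign, then in the upper limit \<open>v\<close>.\<close>

lemma pd_commute:
  assumes f: "smooth2 f"
  shows "pd 1 (pd 0 f) = pd 0 (pd 1 f)"
proof
  fix z
  \<comment> \<open>The lower limit \<open>c\<close> lies strictly below \<open>y\<close>, which
    makes \<open>y\<close> interior to \<open>{c..y + 1}\<close> and the derivative there
    two-sided.\<close>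
  define x y c where "x = Re z" and "y = Im z" and "c = Im z - 1"
  have smooth [simp]: "smooth2 (pd 0 f)" "smooth2 (pd 1 f)" "smooth2 (pd 0 (pd 1 f))"
    using f by simp_all
  have cont: "continuous_on S (\<lambda>t. g (Complex s t))" if "smooth2 g" for g s S
    by (rule smooth2_continuous_compose[OF that]) (auto simp: Complex_eq intro!: continuous_intros)
  have deriv1: "((\<lambda>t. g (Complex s t)) has_real_derivative pd 1 g (Complex s t)) (at t)"
    if "smooth2 g" for g s t
    using smooth2_has_pd[OF that, of 1 "Complex s t"] by (simp add: has_pd_def coord_def coord_line_def)
  have deriv0: "((\<lambda>s. g (Complex s t)) has_real_derivative pd 0 g (Complex s t)) (at s)"
    if "smooth2 g" for g s t
    using smooth2_has_pd[OF that, of 0 "Complex s t"] by (simp add: has_pd_def coord_def coord_line_def)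
  have int: "integral {c..v} (\<lambda>t. pd 1 f (Complex s t)) = f (Complex s v) - f (Complex s c)"
    if "c \<le> v" for s v
    by (rule integral_unique, rule fundamental_theorem_of_calculus[OF that])
      (use deriv1[OF f] in \<open>auto simp: has_real_derivative_iff_has_vector_derivative[symmetric]
        intro: has_field_derivative_at_within\<close>)
  have *: "pd 0 f (Complex x v) = pd 0 f (Complex x c) + integral {c..v} (\<lambda>t. pd 0 (pd 1 f) (Complex x t))"
    if "c \<le> v" for v
  proof -
    have "((\<lambda>s. integral (cbox c v) (\<lambda>t. pd 1 f (Complex s t))) has_field_derivative
        integral (cbox c v) (\<lambda>t. pd 0 (pd 1 f) (Complex x t))) (at x within UNIV)"
    proof (rule leibniz_rule_field_derivative)
      show "(\<lambda>t. pd 1 f (Complex s t)) integrable_on cbox c v" for s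
        by (rule integrable_continuous) (simp add: cont)
      show "continuous_on (UNIV \<times> cbox c v) (\<lambda>(s, t). pd 0 (pd 1 f) (Complex s t))"
        unfolding split_beta
        by (rule smooth2_continuous_compose) (auto simp: Complex_eq intro!: continuous_intros)
    qed (auto simp: deriv0)
    moreover have "((\<lambda>s. f (Complex s v) - f (Complex s c)) has_field_derivative
        pd 0 f (Complex x v) - pd 0 f (Complex x c)) (at x)"
      by (intro derivative_intros deriv0 f)
    ultimately show ?thesis
      using int[OF that] DERIV_unique by fastforce
  qed
  have "((\<lambda>v. pd 0 f (Complex x c) + integral {c..v} (\<lambda>t. pd 0 (pd 1 f) (Complex x t)))
      has_real_derivative 0 + pd 0 (pd 1 f) (Complex x y)) (at y within {c..y + 1})"
    by (intro DERIV_add DERIV_const integral_has_real_derivative cont) (auto simp: y_def c_def)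
  then have "((\<lambda>v. pd 0 f (Complex x v)) has_real_derivative pd 0 (pd 1 f) (Complex x y))
      (at y within {c..y + 1})"
    unfolding add_0 by (rule has_field_derivative_transform_within[where d = 1]) (auto simp: y_def c_def[symmetric] intro!: *[symmetric], simp_all add: c_def)
  moreover have "at y within {c..y + 1} = at y"
    by (rule at_within_interior) (auto simp: y_def c_def)
  ultimately have "pd 1 (pd 0 f) (Complex x y) = pd 0 (pd 1 f) (Complex x y)"
    using deriv1[of "pd 0 f" x y] DERIV_unique by fastforce
  then show "pd 1 (pd 0 f) z = pd 0 (pd 1 f) z"
    by (simp add: x_def y_def)
qed

text \<open>The potential is the integral of the form along the segment from the origin.\<close>

lemma closed_form_potential:
  assumes P: "smooth2 P" and Q: "smooth2 Q" and closed: "pd 1 P = pd 0 Q"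
  obtains \<phi> where "\<And>z. (\<phi> has_derivative (\<lambda>h. P z * Re h + Q z * Im h)) (at z)"
proof -
  define J where "J = (\<lambda>z t. Re z * P (of_real t * z) + Im z * Q (of_real t * z))"
  define \<phi> where "\<phi> = (\<lambda>z. integral (cbox 0 1) (J z))"
  define W where "W = (\<lambda>i::nat. if i = 0 then P else Q)"
  have W [simp]: "smooth2 (W i)" for i
    using P Q by (simp add: W_def)
  \<comment> \<open>The partial derivatives of the integrand in \<open>z\<close>, with closedness
    already used to trade the cross derivative, so that only \<open>W i\<close> is
    differentiated.\<close>
  define J' where
    "J' = (\<lambda>i z t. W i (of_real t * z) +
      t * (Re z * pd 0 (W i) (of_real t * z) + Im z * pd 1 (W i) (of_real t * z)))"
  have scale: "has_pd i (\<lambda>z. g (of_real t * z)) (t * pd i g (of_real t * z)) z"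
    if g: "smooth2 g" and i: "i \<in> {0, 1}" for g i z and t :: real
  proof -
    have "((\<lambda>z. of_real t * z) has_derivative (\<lambda>h. of_real t * h)) (at z)"
      by (auto intro!: derivative_eq_intros)
    from has_derivative_compose[OF this smooth2_has_derivative[OF g]]
    have "((\<lambda>z. g (of_real t * z)) has_derivative (\<lambda>h.
        (t * pd 0 g (of_real t * z)) * Re h + (t * pd 1 g (of_real t * z)) * Im h)) (at z)"
      by (simp add: algebra_simps)
    from has_derivative_imp_has_pd[OF this] i show ?thesis
      by auto
  qed
  have coord: "has_pd i Re (if i = 0 then 1 else 0) z" "has_pd i Im (if i = 0 then 0 else 1) z" for i z
    by (auto simp: has_pd_def coord_def coord_line_def)
  have J: "has_pd i (\<lambda>z. J z t) (J' i z t) z" if i: "i \<in> {0, 1}" for i z t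
  proof -
    have "has_pd i (\<lambda>z. J z t)
      (((if i = 0 then 1 else 0) * P (of_real t * z) + Re z * (t * pd i P (of_real t * z))) +
       ((if i = 0 then 0 else 1) * Q (of_real t * z) + Im z * (t * pd i Q (of_real t * z)))) z"
      unfolding J_def by (intro has_pd_add has_pd_mult coord scale P Q i)
    then show ?thesis
      using i by (auto simp: J'_def W_def closed algebra_simps)
  qed
  \<comment> \<open>In this form \<open>J'\<close> is the \<open>t\<close>-derivative of
    \<open>t * W i (t z)\<close>, which is 0 at \<open>t = 0\<close> and \<open>W i z\<close> at
    \<open>t = 1\<close>.\<close>
  have J'_int: "integral (cbox 0 1) (J' i z) = W i z" for i z
  proof -
    have "((\<lambda>t. t * W i (of_real t * z)) has_real_derivative J' i z t) (at t)" for t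
    proof -
      have "((\<lambda>t. of_real t * z) has_derivative (\<lambda>h. of_real h * z)) (at t)"
        by (auto intro!: derivative_eq_intros)
      from has_derivative_compose[OF this smooth2_has_derivative[OF W[of i]]]
      have "((\<lambda>t. W i (of_real t * z)) has_real_derivative
          Re z * pd 0 (W i) (of_real t * z) + Im z * pd 1 (W i) (of_real t * z)) (at t)"
        by (auto simp: has_field_derivative_def algebra_simps elim!: has_derivative_eq_rhs)
      from DERIV_mult[OF DERIV_ident this] show ?thesis
        by (simp add: J'_def algebra_simps)
    qed
    then have "(J' i z has_integral 1 * W i (of_real 1 * z) - 0 * W i (of_real 0 * z)) {0..1}"
      by (intro fundamental_theorem_of_calculus)
        (auto simp: has_real_derivative_iff_has_vector_derivative[symmetric]
          intro: has_field_derivative_at_within)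
    then show ?thesis
      by (simp add: integral_unique)
  qed
  have \<phi>: "has_pd i \<phi> (W i z) z" if i: "i \<in> {0, 1}" for i z
  proof -
    have cl: "coord_line i (coord_line i z s) = coord_line i z" "coord i (coord_line i z s) = s" for s
      by (auto simp: coord_line_def coord_def fun_eq_iff)
    have "((\<lambda>s. integral (cbox 0 1) (J (coord_line i z s))) has_field_derivative
        integral (cbox 0 1) (J' i (coord_line i z (coord i z)))) (at (coord i z) within UNIV)"
    proof (rule leibniz_rule_field_derivative)
      fix s t
      show "((\<lambda>s. J (coord_line i z s) t) has_real_derivative J' i (coord_line i z s) t) (at s within UNIV)"
        using J[OF i, of t "coord_line i z s"] by (simp add: has_pd_def cl)
      show "J (coord_line i z s) integrable_on cbox 0 1"
        unfolding J_def using P Q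
        by (intro integrable_continuous) (auto intro!: continuous_intros smooth2_continuous_compose)
      have "continuous_on UNIV (coord_line i z)"
        by (cases "i = 0") (auto simp: coord_line_def[abs_def] Complex_eq intro!: continuous_intros)
      then have [continuous_intros]: "continuous_on S (\<lambda>p. coord_line i z (fst p))" for S :: "(real \<times> real) set"
        by (rule continuous_on_compose2) (auto intro!: continuous_intros)
      show "continuous_on (UNIV \<times> cbox 0 1) (\<lambda>(s, t). J' i (coord_line i z s) t)"
        unfolding J'_def split_beta
        by (intro continuous_intros smooth2_continuous_compose W smooth2_pd) auto
    qed auto
    then show ?thesis
      using J'_int[of i z] by (simp add: has_pd_def \<phi>_def)
  qed
  show ?thesis
  proof (rule that)
    show "(\<phi> has_derivative (\<lambda>h. P z * Re h + Q z * Im h)) (at z)" for z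
      using \<phi>[of 0] \<phi>[of 1] by (intro has_derivative_of_partials) (auto simp: W_def smooth2_continuous Q)
  qed
qed

subsection \<open>Killing tensor fields of rank three\<close>

lemma upt_4: "[0..<4] = [0, 1, 2, 3]"
  by (simp add: eval_nat_numeral One_nat_def)

text \<open>Symmetrisation is stated through sums over permutations. The expansions serve the
  product of metric and vector field (3) and the Killing equations of rank 1 (2) and rank 3
  (4).\<close>

lemma sum_permutations_3:
  fixes h :: "nat \<Rightarrow> nat \<Rightarrow> nat \<Rightarrow> real"
  shows "(\<Sum>\<pi> | \<pi> permutes {..<3}. h (\<pi> 0) (\<pi> 1) (\<pi> 2)) =
    h 0 1 2 + h 0 2 1 + h 1 0 2 + h 1 2 0 + h 2 0 1 + h 2 1 0"
proof -
  have e: "{..<3::nat} = {0, 1, 2}"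
    by auto
  show ?thesis
    unfolding e
    by (simp add: sum_over_permutations_insert permutes_sing Transposition.transpose_def)
qed

lemma sum_permutations_2:
  fixes h :: "nat \<Rightarrow> nat \<Rightarrow> real"
  shows "(\<Sum>\<pi> | \<pi> permutes {..<2}. h (\<pi> 0) (\<pi> 1)) = h 0 1 + h 1 0"
proof -
  have e: "{..<2::nat} = {0, 1}"
    by auto
  show ?thesis
    unfolding e
    by (simp add: sum_over_permutations_insert permutes_sing Transposition.transpose_def)
qed

lemma sum_permutations_4:
  fixes h :: "nat \<Rightarrow> nat \<Rightarrow> nat \<Rightarrow> nat \<Rightarrow> real"
  shows "(\<Sum>\<pi> | \<pi> permutes {..<4}. h (\<pi> 0) (\<pi> 1) (\<pi> 2) (\<pi> 3)) =
    h 0 1 2 3 + h 0 1 3 2 + h 0 2 1 3 + h 0 2 3 1 + h 0 3 1 2 + h 0 3 2 1 +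
    h 1 0 2 3 + h 1 0 3 2 + h 1 2 0 3 + h 1 2 3 0 + h 1 3 0 2 + h 1 3 2 0 +
    h 2 0 1 3 + h 2 0 3 1 + h 2 1 0 3 + h 2 1 3 0 + h 2 3 0 1 + h 2 3 1 0 +
    h 3 0 1 2 + h 3 0 2 1 + h 3 1 0 2 + h 3 1 2 0 + h 3 2 0 1 + h 3 2 1 0"
proof -
  have e: "{..<4::nat} = {0, 1, 2, 3}"
    by auto
  show ?thesis
    unfolding e
    by (simp add: sum_over_permutations_insert permutes_sing Transposition.transpose_def)
qed

lemma permute_list_by_eq: "permute_list_by \<pi> is = permute_list \<pi> is"
  by (simp add: permute_list_by_def permute_list_def)

text \<open>Lists with equal multisets differ by a permutation; in rank 3 this leaves four
  components to consider.\<close>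

lemma sym_tensor_field_mset_cong:
  assumes "sym_tensor_field \<omega>1 \<omega>2 m T" "is \<in> idx_lists m" "mset is = mset js"
  shows "T is = T js"
proof -
  obtain \<pi> where \<pi>: "\<pi> permutes {..<length is}" "permute_list \<pi> is = js"
    using assms(3) mset_eq_permutation by metis
  then have "permute_list_by \<pi> is = js"
    by (simp add: permute_list_by_eq)
  with assms(1,2) \<pi>(1) show ?thesis
    unfolding sym_tensor_field_def by (metis (mono_tags, lifting) idx_lists_def mem_Collect_eq)
qed

text \<open>The symmetrised covariant derivative gives one equation for each number of ones among
  the four indices, hence five.\<close>

lemma killing_3_components:
  assumes "killing \<omega>1 \<omega>2 \<mu> 3 T"
  defines "f0 \<equiv> T [0, 0, 0]" and "f1 \<equiv> T [0, 0, 1]" and "f2 \<equiv> T [0, 1, 1]" and "f3 \<equiv> T [1, 1, 1]"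
  shows "pd 0 f0 z = 3 * (pd 0 \<mu> z * f0 z - pd 1 \<mu> z * f1 z)" (is "?C1")
    "3 * pd 0 f1 z + pd 1 f0 z =
      6 * pd 1 \<mu> z * f0 z + 12 * pd 0 \<mu> z * f1 z - 6 * pd 1 \<mu> z * f2 z" (is "?C2")
    "pd 0 f2 z + pd 1 f1 z =
      - pd 0 \<mu> z * f0 z + 5 * pd 1 \<mu> z * f1 z + 5 * pd 0 \<mu> z * f2 z - pd 1 \<mu> z * f3 z" (is "?C3")
    "pd 0 f3 z + 3 * pd 1 f2 z =
      - 6 * pd 0 \<mu> z * f1 z + 12 * pd 1 \<mu> z * f2 z + 6 * pd 0 \<mu> z * f3 z" (is "?C4")
    "pd 1 f3 z = 3 * (pd 1 \<mu> z * f3 z - pd 0 \<mu> z * f2 z)" (is "?C5")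
proof -
  have sym: "sym_tensor_field \<omega>1 \<omega>2 3 T"
    using assms by (simp add: killing_def)
  have eqs [simp]: "T [0, 1, 0] = f1" "T [1, 0, 0] = f1" "T [1, 0, 1] = f2" "T [1, 1, 0] = f2"
    "T [0, 0, 0] = f0" "T [0, 0, 1] = f1" "T [0, 1, 1] = f2" "T [1, 1, 1] = f3"
    unfolding f0_def f1_def f2_def f3_def
    by (auto intro!: sym_tensor_field_mset_cong[OF sym] simp: idx_lists_def)
  have nabla: "cov_deriv \<mu> T [l, i, j, k] z = pd l (T [i, j, k]) z
    - (christoffel \<mu> 0 l i z * T [0, j, k] z + christoffel \<mu> 1 l i z * T [1, j, k] z)
    - (christoffel \<mu> 0 l j z * T [i, 0, k] z + christoffel \<mu> 1 l j z * T [i, 1, k] z)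
    - (christoffel \<mu> 0 l k z * T [i, j, 0] z + christoffel \<mu> 1 l k z * T [i, j, 1] z)" for l i j k z
    by (simp add: cov_deriv_def numeral_2_eq_2 numeral_3_eq_3 One_nat_def)
  \<comment> \<open>The covariant derivative is symmetric in its last three slots, so the 24
    summands are of at most two kinds, told apart by the differentiation index.\<close>
  have sorted: "cov_deriv \<mu> T [l, 0, 1, 0] z = cov_deriv \<mu> T [l, 0, 0, 1] z"
    "cov_deriv \<mu> T [l, 1, 0, 0] z = cov_deriv \<mu> T [l, 0, 0, 1] z"
    "cov_deriv \<mu> T [l, 1, 0, 1] z = cov_deriv \<mu> T [l, 0, 1, 1] z"
    "cov_deriv \<mu> T [l, 1, 1, 0] z = cov_deriv \<mu> T [l, 0, 1, 1] z" for l z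
    by (simp_all add: nabla)
  have kill: "(\<Sum>\<pi> | \<pi> permutes {..<4}. cov_deriv \<mu> T [is ! \<pi> 0, is ! \<pi> 1, is ! \<pi> 2, is ! \<pi> 3] z) = 0"
    if "is \<in> idx_lists 4" for "is" z
  proof -
    have "(\<Sum>\<pi> | \<pi> permutes {..<4}. cov_deriv \<mu> T (permute_list_by \<pi> is) z) = 0"
      using assms(1) that by (simp add: killing_def)
    then show ?thesis
      using that by (simp add: permute_list_by_def idx_lists_def upt_4)
  qed
  note k = trans[OF sum_permutations_4[of "\<lambda>a b c d. cov_deriv \<mu> T [is ! a, is ! b, is ! c, is ! d] z" for "is" z, symmetric] kill]
  have nth: "[a, b, c, d] ! 0 = a" "[a, b, c, d] ! 1 = b" "[a, b, c, d] ! 2 = c" "[a, b, c, d] ! 3 = d"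
    for a b c d :: nat
    by simp_all
  have "cov_deriv \<mu> T [0, 0, 0, 0] z = 0"
    "3 * cov_deriv \<mu> T [0, 0, 0, 1] z + cov_deriv \<mu> T [1, 0, 0, 0] z = 0"
    "cov_deriv \<mu> T [0, 0, 1, 1] z + cov_deriv \<mu> T [1, 0, 0, 1] z = 0"
    "cov_deriv \<mu> T [0, 1, 1, 1] z + 3 * cov_deriv \<mu> T [1, 0, 1, 1] z = 0"
    "cov_deriv \<mu> T [1, 1, 1, 1] z = 0"
    using k[of "[0,0,0,0]" z] k[of "[0,0,0,1]" z] k[of "[0,0,1,1]" z] k[of "[0,1,1,1]" z] k[of "[1,1,1,1]" z]
    unfolding nth sorted by (simp_all add: idx_lists_def)
  then show "?C1" "?C2" "?C3" "?C4" "?C5"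
    by (simp_all add: nabla christoffel_def algebra_simps)
qed

text \<open>Up to the factor 3 in \<open>u\<close>, the functions below are \<open>a = a1 + i a2\<close> and \<open>u = u1 + i u2\<close>.\<close>

lemma killing_3_reduced_system:
  assumes kill: "killing \<omega>1 \<omega>2 \<mu> 3 T" and \<mu> [simp]: "smooth2 \<mu>"
    and E_def: "E = (\<lambda>z. exp (- 2 * \<mu> z))" and L_def: "L = (\<lambda>z. exp (2 * \<mu> z))"
    and a1_def: "a1 = (\<lambda>z. E z ^ 3 * (T [0, 0, 0] z - 3 * T [0, 1, 1] z))"
    and a2_def: "a2 = (\<lambda>z. E z ^ 3 * (3 * T [0, 0, 1] z - T [1, 1, 1] z))"
    and u1_def: "u1 = (\<lambda>z. E z ^ 2 * (T [0, 0, 0] z + T [0, 1, 1] z))"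
    and u2_def: "u2 = (\<lambda>z. E z ^ 2 * (T [0, 0, 1] z + T [1, 1, 1] z))"
  shows "pd 0 a1 z = pd 1 a2 z" "pd 1 a1 z = - pd 0 a2 z"
    "pd 0 u1 z - pd 1 u2 z = - (a1 z * pd 0 L z + a2 z * pd 1 L z) - 2 / 3 * L z * pd 0 a1 z"
    "pd 0 u2 z + pd 1 u1 z = a1 z * pd 1 L z - a2 z * pd 0 L z - 2 / 3 * L z * pd 0 a2 z"
    "pd 0 (\<lambda>z. L z * u1 z) z + pd 1 (\<lambda>z. L z * u2 z) z = 0"
proof -
  have T [simp]: "smooth2 (T [i, j, k])" if "{i, j, k} \<subseteq> {0, 1}" for i j k
    using kill that by (auto simp: killing_def sym_tensor_field_def idx_lists_def)
  have [simp]: "smooth2 E" "smooth2 L"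
    by (simp_all add: E_def L_def)
  have Ex [simp]: "pd i E = (\<lambda>z. - 2 * E z * pd i \<mu> z)" if "i \<in> {0, 1}" for i
    using that by (auto simp: E_def fun_eq_iff)
  have Lx [simp]: "pd i L = (\<lambda>z. 2 * L z * pd i \<mu> z)" if "i \<in> {0, 1}" for i
    using that by (auto simp: L_def fun_eq_iff)
  have LE: "L z * E z = 1"
    by (simp add: L_def E_def exp_minus)
  note K = killing_3_components[OF kill, of z]
  \<comment> \<open>The Killing equations are solved for five of the eight first derivatives of the
    components; the claims are then algebraic in the remaining three.\<close>
  have eqs: "pd 1 (T [0, 0, 0]) z = 6 * pd 1 \<mu> z * T [0, 0, 0] z + 12 * pd 0 \<mu> z * T [0, 0, 1] z
      - 6 * pd 1 \<mu> z * T [0, 1, 1] z - 3 * pd 0 (T [0, 0, 1]) z"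
    "pd 1 (T [0, 0, 1]) z = - pd 0 \<mu> z * T [0, 0, 0] z + 5 * pd 1 \<mu> z * T [0, 0, 1] z
      + 5 * pd 0 \<mu> z * T [0, 1, 1] z - pd 1 \<mu> z * T [1, 1, 1] z - pd 0 (T [0, 1, 1]) z"
    "pd 0 (T [1, 1, 1]) z = - 6 * pd 0 \<mu> z * T [0, 0, 1] z + 12 * pd 1 \<mu> z * T [0, 1, 1] z
      + 6 * pd 0 \<mu> z * T [1, 1, 1] z - 3 * pd 1 (T [0, 1, 1]) z"
    using K(2-4) by simp_all
  note eqs = eqs K(1,5)
  show "pd 0 a1 z = pd 1 a2 z" "pd 1 a1 z = - pd 0 a2 z"
    by (simp_all add: a1_def a2_def power3_eq_cube eqs algebra_simps)
  have aL: "a1 z * L z = E z ^ 2 * (T [0, 0, 0] z - 3 * T [0, 1, 1] z)"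
    "a2 z * L z = E z ^ 2 * (3 * T [0, 0, 1] z - T [1, 1, 1] z)"
    using LE by (simp_all add: a1_def a2_def power3_eq_cube power2_eq_square, algebra+)
  have ax: "pd 0 a1 z * L z = E z ^ 2 *
      (pd 0 (T [0, 0, 0]) z - 3 * pd 0 (T [0, 1, 1]) z) - 6 * pd 0 \<mu> z * (a1 z * L z)"
    "pd 0 a2 z * L z = E z ^ 2 *
      (3 * pd 0 (T [0, 0, 1]) z - pd 0 (T [1, 1, 1]) z) - 6 * pd 0 \<mu> z * (a2 z * L z)"
    using LE by (simp_all add: a1_def a2_def power3_eq_cube power2_eq_square, algebra+)
  \<comment> \<open>At this point \<open>a\<close> is not known to be constant, whence the terms
    with its derivatives; they vanish once it is.\<close>
  have "pd 0 u1 z - pd 1 u2 z = - 2 * (pd 0 \<mu> z * (a1 z * L z) + pd 1 \<mu> z * (a2 z * L z))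
      - 2 / 3 * (pd 0 a1 z * L z)"
    "pd 0 u2 z + pd 1 u1 z = 2 * (pd 1 \<mu> z * (a1 z * L z) - pd 0 \<mu> z * (a2 z * L z))
      - 2 / 3 * (pd 0 a2 z * L z)"
    unfolding ax aL by (simp_all add: u1_def u2_def power2_eq_square eqs algebra_simps)
  then show "pd 0 u1 z - pd 1 u2 z = - (a1 z * pd 0 L z + a2 z * pd 1 L z) - 2 / 3 * L z * pd 0 a1 z"
    "pd 0 u2 z + pd 1 u1 z = a1 z * pd 1 L z - a2 z * pd 0 L z - 2 / 3 * L z * pd 0 a2 z"
    by (simp_all add: algebra_simps)
  show "pd 0 (\<lambda>z. L z * u1 z) z + pd 1 (\<lambda>z. L z * u2 z) z = 0"
    by (simp add: u1_def u2_def power2_eq_square eqs algebra_simps)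
qed

subsection \<open>Doubly periodic functions\<close>

text \<open>Cramer's rule; the determinant \<open>d\<close> is
  \<open>Im (cnj \<omega>1 * \<omega>2)\<close>.\<close>

lemma lattice_coordinates:
  assumes "is_lattice_basis \<omega>1 \<omega>2"
  obtains s t where "z = of_real s * \<omega>1 + of_real t * \<omega>2"
proof
  define d where "d = Re \<omega>1 * Im \<omega>2 - Im \<omega>1 * Re \<omega>2"
  have "d \<noteq> 0"
    using assms by (simp add: is_lattice_basis_def d_def)
  then have "Re z = (Re z * Im \<omega>2 - Im z * Re \<omega>2) / d * Re \<omega>1 + (Re \<omega>1 * Im z - Im \<omega>1 * Re z) / d * Re \<omega>2"
    "Im z = (Re z * Im \<omega>2 - Im z * Re \<omega>2) / d * Im \<omega>1 + (Re \<omega>1 * Im z - Im \<omega>1 * Re z) / d * Im \<omega>2"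
    by (simp_all add: field_simps) (simp_all add: d_def algebra_simps)
  then show "z = of_real ((Re z * Im \<omega>2 - Im z * Re \<omega>2) / d) * \<omega>1 +
      of_real ((Re \<omega>1 * Im z - Im \<omega>1 * Re z) / d) * \<omega>2"
    by (simp add: complex_eq_iff)
qed

lemma translation_of_int:
  fixes f :: "complex \<Rightarrow> real"
  assumes "\<And>z. f (z + \<omega>) = f z + c"
  shows "f (z + of_int m * \<omega>) = f z + of_int m * c"
proof (induction m rule: int_induct[where k = 0])
  case (step1 i)
  then show ?case
    using assms[of "z + of_int i * \<omega>"] by (simp add: algebra_simps)
next
  case (step2 i)
  then show ?case
    using assms[of "z + of_int (i - 1) * \<omega>"] by (simp add: algebra_simps)
qed simp

lemma translation_lattice:
  fixes f :: "complex \<Rightarrow> real"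
  assumes "\<And>z. f (z + \<omega>1) = f z + c1" "\<And>z. f (z + \<omega>2) = f z + c2"
  shows "f (z + of_int m * \<omega>1 + of_int n * \<omega>2) = f z + of_int m * c1 + of_int n * c2"
  by (simp add: translation_of_int[of f \<omega>1 c1] translation_of_int[of f \<omega>2 c2] assms)

text \<open>Taking fractional parts of the lattice coordinates shows that every value is attained on
  one compact fundamental parallelogram.\<close>

lemma periodic_bounded:
  assumes "is_lattice_basis \<omega>1 \<omega>2" "periodic \<omega>1 \<omega>2 f" "continuous_on UNIV f"
  shows "bounded (range f)"
proof -
  define g where "g = (\<lambda>p. of_real (fst p) * \<omega>1 + of_real (snd p) * \<omega>2)"
  have "compact ((f \<circ> g) ` cbox (0, 0) (1, 1))"
    unfolding g_def comp_def
    by (intro compact_continuous_image continuous_on_compose2[OF assms(3)] continuous_intros) auto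
  moreover have "range f \<subseteq> (f \<circ> g) ` cbox (0, 0) (1, 1)"
  proof
    fix y
    assume "y \<in> range f"
    then obtain z where z: "y = f z"
      by blast
    obtain s t where st: "z = of_real s * \<omega>1 + of_real t * \<omega>2"
      using lattice_coordinates[OF assms(1)] .
    have "z = g (frac s, frac t) + of_int \<lfloor>s\<rfloor> * \<omega>1 + of_int \<lfloor>t\<rfloor> * \<omega>2"
      by (simp add: st g_def frac_def algebra_simps)
    then have "f z = f (g (frac s, frac t))"
      using assms(2) translation_lattice[of f \<omega>1 0 \<omega>2 0] by (simp add: periodic_def)
    then show "y \<in> (f \<circ> g) ` cbox (0, 0) (1, 1)"
      using z frac_lt_1[of s] frac_lt_1[of t] by (auto intro!: image_eqI[of _ _ "(frac s, frac t)"])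
  qed
  ultimately show ?thesis
    using bounded_subset compact_imp_bounded by blast
qed

text \<open>The equations make \<open>f + \<i> g\<close> entire and periodicity makes it bounded, so
  Liouville's theorem applies. It serves for \<open>a\<close>, and for \<open>u\<close> when
  \<open>a\<close> vanishes.\<close>

lemma periodic_Cauchy_Riemann_constant:
  assumes basis: "is_lattice_basis \<omega>1 \<omega>2"
    and f: "smooth2 f" "periodic \<omega>1 \<omega>2 f" and g: "smooth2 g" "periodic \<omega>1 \<omega>2 g"
    and CR: "\<And>z. pd 0 f z = pd 1 g z" "\<And>z. pd 1 f z = - pd 0 g z"
  obtains c d where "f = (\<lambda>z. c)" "g = (\<lambda>z. d)"
proof -
  define F where "F = (\<lambda>z. of_real (f z) + \<i> * of_real (g z))"
  have "(F has_field_derivative (of_real (pd 0 f z) + \<i> * of_real (pd 0 g z))) (at z)" for z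
  proof -
    have "(F has_derivative (\<lambda>h. of_real (pd 0 f z * Re h + pd 1 f z * Im h) +
        \<i> * of_real (pd 0 g z * Re h + pd 1 g z * Im h))) (at z)"
      unfolding F_def
      by (intro has_derivative_add has_derivative_mult_right smooth2_has_derivative f g
          bounded_linear.has_derivative[OF bounded_linear_of_real])
    then show ?thesis
      unfolding has_field_derivative_def
      by (rule has_derivative_eq_rhs) (auto simp: fun_eq_iff complex_eq_iff CR algebra_simps)
  qed
  then have "F holomorphic_on UNIV"
    by (auto simp: holomorphic_on_open)
  moreover have "bounded (range F)"
  proof -
    obtain A B where "\<And>z. \<bar>f z\<bar> \<le> A" "\<And>z. \<bar>g z\<bar> \<le> B"
      using periodic_bounded[OF basis f(2) smooth2_continuous[OF f(1)]]
        periodic_bounded[OF basis g(2) smooth2_continuous[OF g(1)]]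
      by (auto simp: bounded_iff)
    then have "norm (F z) \<le> A + B" for z
      unfolding F_def by (intro order.trans[OF norm_triangle_ineq] add_mono) (auto simp: norm_mult)
    then show ?thesis
      by (auto simp: bounded_iff)
  qed
  ultimately obtain w where w: "F z = w" for z
    using Liouville_theorem by (force simp: constant_on_def)
  have "f z = Re w" "g z = Im w" for z
    unfolding w[of z, symmetric]     by (auto simp: F_def)
  then show ?thesis
    by (intro that[of "Re w" "Im w"]) auto
qed

text \<open>Translating by a lattice vector changes the potential of a periodic form by a constant.
  The constants of the two generators fix a linear functional on the lattice: the cohomology class
  of the form.\<close>

lemma periodic_form_potential_periods:
  assumes basis: "is_lattice_basis \<omega>1 \<omega>2"
    and \<phi>: "\<And>z. (\<phi> has_derivative (\<lambda>h. P z * Re h + Q z * Im h)) (at z)"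
    and per: "periodic \<omega>1 \<omega>2 P" "periodic \<omega>1 \<omega>2 Q"
  obtains \<alpha> \<beta> :: real where
    "\<And>z w. w - z \<in> lattice \<omega>1 \<omega>2 \<Longrightarrow> \<phi> w - \<phi> z = \<alpha> * Re (w - z) + \<beta> * Im (w - z)"
proof -
  have shift: "\<exists>c. \<forall>z. \<phi> (z + \<omega>) = \<phi> z + c"
    if "\<And>z. P (z + \<omega>) = P z" "\<And>z. Q (z + \<omega>) = Q z" for \<omega>
  proof -
    have "((\<lambda>z. z + \<omega>) has_derivative (\<lambda>h. h)) (at z)" for z
      by (auto intro!: derivative_eq_intros)
    from has_derivative_diff[OF has_derivative_compose[OF this \<phi>] \<phi>] that
    have "((\<lambda>z. \<phi> (z + \<omega>) - \<phi> z) has_derivative (\<lambda>h. 0)) (at z within UNIV)" for z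
      by simp
    then obtain c where "\<And>z. \<phi> (z + \<omega>) - \<phi> z = c"
      using has_derivative_zero_constant[of UNIV "\<lambda>z. \<phi> (z + \<omega>) - \<phi> z"] by auto
    then show ?thesis
      by (intro exI[of _ c]) (simp add: algebra_simps)
  qed
  obtain c1 c2 where c: "\<And>z. \<phi> (z + \<omega>1) = \<phi> z + c1" "\<And>z. \<phi> (z + \<omega>2) = \<phi> z + c2"
    using shift[of \<omega>1] shift[of \<omega>2] per by (auto simp: periodic_def)
  define d where "d = Re \<omega>1 * Im \<omega>2 - Im \<omega>1 * Re \<omega>2"
  have d: "d \<noteq> 0"
    using basis by (simp add: is_lattice_basis_def d_def)
  \<comment> \<open>Cramer's rule for the constant form \<open>\<alpha> dx + \<beta> dy\<close>
    whose periods on the generators are \<open>c1\<close> and \<open>c2\<close>.\<close>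
  define \<alpha> \<beta> where "\<alpha> = (c1 * Im \<omega>2 - c2 * Im \<omega>1) / d" and "\<beta> = (c2 * Re \<omega>1 - c1 * Re \<omega>2) / d"
  have *: "\<alpha> * Re \<omega>1 + \<beta> * Im \<omega>1 = c1" "\<alpha> * Re \<omega>2 + \<beta> * Im \<omega>2 = c2"
    using d by (simp_all add: \<alpha>_def \<beta>_def field_simps) (simp_all add: d_def algebra_simps)
  show ?thesis
  proof (rule that)
    fix z w
    assume "w - z \<in> lattice \<omega>1 \<omega>2"
    then obtain m n :: int where mn: "w - z = of_int m * \<omega>1 + of_int n * \<omega>2"
      by (auto simp: lattice_def)
    then have "w = z + of_int m * \<omega>1 + of_int n * \<omega>2"
      by (simp add: algebra_simps)
    then have "\<phi> w - \<phi> z = of_int m * c1 + of_int n * c2"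
      using translation_lattice[of \<phi>, OF c] by simp
    then show "\<phi> w - \<phi> z = \<alpha> * Re (w - z) + \<beta> * Im (w - z)"
      unfolding mn *[symmetric] by (simp add: algebra_simps)
  qed
qed

subsection \<open>Products of the metric and a vector field\<close>

lemma idx_lists_cases:
  "is \<in> idx_lists 1 \<longleftrightarrow> is = [0] \<or> is = [1]"
  "is \<in> idx_lists 2 \<longleftrightarrow> (\<exists>a b. is = [a, b] \<and> {a, b} \<subseteq> {0, 1})"
  "is \<in> idx_lists 3 \<longleftrightarrow> (\<exists>a b c. is = [a, b, c] \<and> {a, b, c} \<subseteq> {0, 1})"
  by (auto simp: idx_lists_def eval_nat_numeral One_nat_def length_Suc_conv)

lemma upt_1_2_3: "[0..<1] = [0]" "[0..<2] = [0, 1]" "[0..<3] = [0, 1, 2]" "[2..<3] = [2]"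
  by (simp_all add: eval_nat_numeral One_nat_def)

definition metric_tensor :: "(complex \<Rightarrow> real) \<Rightarrow> tfield" where
  "metric_tensor \<mu> is z = (if is ! 0 = is ! 1 then exp (2 * \<mu> z) else 0)"

text \<open>Covariant components of the vector field with constant contravariant components \<open>(w0, w1)\<close>.\<close>

definition constant_vector_field :: "(complex \<Rightarrow> real) \<Rightarrow> real \<Rightarrow> real \<Rightarrow> tfield" where
  "constant_vector_field \<mu> w0 w1 is z = exp (2 * \<mu> z) * (if is ! 0 = 0 then w0 else w1)"

lemma metric_tensor_commute: "metric_tensor \<mu> [i, j] z = metric_tensor \<mu> [j, i] z"
  by (simp add: metric_tensor_def)

text \<open>The metric is parallel, so every summand of the symmetrised derivative vanishes by
  itself.\<close>

lemma killing_metric_tensor: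
  assumes \<mu>: "smooth2 \<mu>" "periodic \<omega>1 \<omega>2 \<mu>"
  shows "killing \<omega>1 \<omega>2 \<mu> 2 (metric_tensor \<mu>)"
proof -
  have [simp]: "metric_tensor \<mu> [0, 0] = (\<lambda>z. exp (2 * \<mu> z))" "metric_tensor \<mu> [1, 1] = (\<lambda>z. exp (2 * \<mu> z))"
    "metric_tensor \<mu> [0, 1] = (\<lambda>z. 0)" "metric_tensor \<mu> [1, 0] = (\<lambda>z. 0)"
    by (simp_all add: metric_tensor_def fun_eq_iff)
  have nabla: "cov_deriv \<mu> (metric_tensor \<mu>) [l, i, j] z = 0" if "{l, i, j} \<subseteq> {0, 1}" for l i j z
  proof -
    have "cov_deriv \<mu> G [l, i, j] z = pd l (G [i, j]) z
      - (christoffel \<mu> 0 l i z * G [0, j] z + christoffel \<mu> 1 l i z * G [1, j] z)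
      - (christoffel \<mu> 0 l j z * G [i, 0] z + christoffel \<mu> 1 l j z * G [i, 1] z)" for G
      by (simp add: cov_deriv_def numeral_2_eq_2 One_nat_def)
    moreover have "l = 0 \<or> l = 1" "i = 0 \<or> i = 1" "j = 0 \<or> j = 1"
      using that by auto
    ultimately show ?thesis
      using \<mu>(1) by (elim disjE) (simp_all add: christoffel_def)
  qed
  have "sym_tensor_field \<omega>1 \<omega>2 2 (metric_tensor \<mu>)"
  proof -
    have "metric_tensor \<mu> (permute_list_by \<pi> [a, b]) = metric_tensor \<mu> [a, b]"
      if "\<pi> permutes {..<2}" for \<pi> a b
    proof -
      have "\<pi> 0 \<in> {..<2}" "\<pi> 1 \<in> {..<2}" "\<pi> 0 \<noteq> \<pi> 1"
        using permutes_in_image[OF that] permutes_inj[OF that] by (auto simp: inj_eq)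
      then have "\<pi> 0 = 0 \<and> \<pi> 1 = 1 \<or> \<pi> 0 = 1 \<and> \<pi> 1 = 0"
        by auto
      then show ?thesis
        by (auto simp: metric_tensor_def fun_eq_iff permute_list_by_def upt_1_2_3 simp del: upt_Suc)
    qed
    then show ?thesis
      using \<mu> by (auto simp: sym_tensor_field_def idx_lists_cases periodic_def)
  qed
  moreover have "cov_deriv \<mu> (metric_tensor \<mu>) (permute_list_by \<pi> is) z = 0"
    if "is \<in> idx_lists 3" "\<pi> permutes {..<3}" for \<pi> "is" z
  proof -
    have "permute_list_by \<pi> is \<in> idx_lists 3"
      using that by (auto simp: permute_list_by_eq idx_lists_def)
    then obtain l i j where "permute_list_by \<pi> is = [l, i, j]" "{l, i, j} \<subseteq> {0, 1}"
      unfolding idx_lists_cases by metis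
    then show ?thesis
      using nabla by simp
  qed
  ultimately show ?thesis
    unfolding killing_def by (auto intro!: sum.neutral)
qed

text \<open>By \<open>div\<close>, translations along \<open>(w0, w1)\<close> preserve the conformal
  factor and are therefore isometries.\<close>

lemma killing_constant_vector_field:
  assumes \<mu>: "smooth2 \<mu>" "periodic \<omega>1 \<omega>2 \<mu>"
    and div: "\<And>z. w0 * pd 0 \<mu> z + w1 * pd 1 \<mu> z = 0"
  shows "killing \<omega>1 \<omega>2 \<mu> 1 (constant_vector_field \<mu> w0 w1)"
proof -
  let ?X = "constant_vector_field \<mu> w0 w1"
  have X [simp]: "?X [0] = (\<lambda>z. exp (2 * \<mu> z) * w0)" "?X [1] = (\<lambda>z. exp (2 * \<mu> z) * w1)"
    by (simp_all add: constant_vector_field_def fun_eq_iff)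
  have "permute_list \<pi> is = is" if "\<pi> permutes {..<1}" for \<pi> and "is" :: "nat list"
    using that by (simp add: One_nat_def permutes_sing lessThan_Suc)
  then have "sym_tensor_field \<omega>1 \<omega>2 1 ?X"
    using \<mu> by (auto simp: sym_tensor_field_def idx_lists_cases periodic_def permute_list_by_eq)
  moreover have "(\<Sum>\<pi> | \<pi> permutes {..<2}. cov_deriv \<mu> ?X (permute_list_by \<pi> is) z) = 0"
    if "is \<in> idx_lists 2" for "is" z
  proof -
    obtain a b where ab: "is = [a, b]" "a = 0 \<or> a = 1" "b = 0 \<or> b = 1"
      using \<open>is \<in> idx_lists 2\<close> by (auto simp: idx_lists_cases)
    have "(\<Sum>\<pi> | \<pi> permutes {..<2}. cov_deriv \<mu> ?X (permute_list_by \<pi> is) z) =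
      (\<Sum>\<pi> | \<pi> permutes {..<2}. cov_deriv \<mu> ?X [is ! \<pi> 0, is ! \<pi> 1] z)"
      using that by (simp add: permute_list_by_def idx_lists_def upt_1_2_3)
    also have "\<dots> = cov_deriv \<mu> ?X [a, b] z + cov_deriv \<mu> ?X [b, a] z"
      using sum_permutations_2[of "\<lambda>i j. cov_deriv \<mu> ?X [is ! i, is ! j] z"] by (simp add: ab)
    also have "\<dots> = 0"
    proof -
      have nabla: "cov_deriv \<mu> ?X [l, i] z = pd l (?X [i]) z
        - (christoffel \<mu> 0 l i z * ?X [0] z + christoffel \<mu> 1 l i z * ?X [1] z)" for l i
        by (simp add: cov_deriv_def numeral_2_eq_2 One_nat_def)
      have "exp (2 * \<mu> z) * (w0 * pd 0 \<mu> z + w1 * pd 1 \<mu> z) = 0"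
        using div[of z] by simp
      then show ?thesis
        using ab(2,3) \<mu>(1) by (elim disjE) (simp_all add: nabla christoffel_def algebra_simps)
    qed
    finally show ?thesis .
  qed
  ultimately show ?thesis
    by (simp add: killing_def)
qed

text \<open>Symmetry of the metric makes the six permutations agree in pairs, which turns
  \<open>1 / 6\<close> into \<open>1 / 3\<close>.\<close>

lemma symprod_metric_constant_vector_field:
  assumes "is \<in> idx_lists 3"
  shows "symprod_list [(2, metric_tensor \<mu>), (1, constant_vector_field \<mu> w0 w1)] is z = (1 / 3) *
    (metric_tensor \<mu> [is ! 0, is ! 1] z * constant_vector_field \<mu> w0 w1 [is ! 2] z +
     metric_tensor \<mu> [is ! 0, is ! 2] z * constant_vector_field \<mu> w0 w1 [is ! 1] z +
     metric_tensor \<mu> [is ! 1, is ! 2] z * constant_vector_field \<mu> w0 w1 [is ! 0] z)"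
proof -
  let ?G = "metric_tensor \<mu>" and ?X = "constant_vector_field \<mu> w0 w1"
  \<comment> \<open>\<open>symprod_list\<close> ends with the rank 0 unit, which is removed
    here.\<close>
  have X: "symprod 1 ?X 0 (\<lambda>is z. 1) js z = ?X [js ! 0] z" for js
  proof -
    have "{\<pi>. \<pi> permutes {..<1::nat}} = {id}"
      by (simp add: One_nat_def permutes_sing lessThan_Suc)
    then show ?thesis
      by (simp add: symprod_def upt_1_2_3 del: upt_Suc)
  qed
  have "symprod_list [(2, ?G), (1, ?X)] is z =
    (1 / 6) * (\<Sum>\<pi> | \<pi> permutes {..<3}. ?G [is ! \<pi> 0, is ! \<pi> 1] z * ?X [is ! \<pi> 2] z)"
    by (simp add: symprod_def[of 2] X upt_1_2_3 fact_numeral del: upt_Suc)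
  also have "\<dots> = (1 / 3) * (?G [is ! 0, is ! 1] z * ?X [is ! 2] z +
      ?G [is ! 0, is ! 2] z * ?X [is ! 1] z + ?G [is ! 1, is ! 2] z * ?X [is ! 0] z)"
    using sum_permutations_3[of "\<lambda>i j k. ?G [is ! i, is ! j] z * ?X [is ! k] z"]
      metric_tensor_commute[of \<mu> "is ! 1" "is ! 0" z] metric_tensor_commute[of \<mu> "is ! 2" "is ! 0" z]
      metric_tensor_commute[of \<mu> "is ! 2" "is ! 1" z]
    by (simp add: algebra_simps)
  finally show ?thesis .
qed

text \<open>These are the components of metric times vector field: three equal contributions when
  all indices agree, a single one otherwise.\<close>

lemma reducible_killing_3:
  assumes \<mu>: "smooth2 \<mu>" "periodic \<omega>1 \<omega>2 \<mu>"
    and div: "\<And>z. w0 * pd 0 \<mu> z + w1 * pd 1 \<mu> z = 0"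
    and sym: "sym_tensor_field \<omega>1 \<omega>2 3 T"
    and T: "\<And>z. T [0, 0, 0] z = exp (2 * \<mu> z) ^ 2 * w0" "\<And>z. T [0, 0, 1] z = exp (2 * \<mu> z) ^ 2 * w1 / 3"
      "\<And>z. T [0, 1, 1] z = exp (2 * \<mu> z) ^ 2 * w0 / 3" "\<And>z. T [1, 1, 1] z = exp (2 * \<mu> z) ^ 2 * w1"
  shows "reducible_killing \<omega>1 \<omega>2 \<mu> 3 T"
proof -
  let ?F = "[(2, metric_tensor \<mu>), (1, constant_vector_field \<mu> w0 w1)]"
  have eqs: "T [0, 1, 0] = T [0, 0, 1]" "T [1, 0, 0] = T [0, 0, 1]"
    "T [1, 0, 1] = T [0, 1, 1]" "T [1, 1, 0] = T [0, 1, 1]"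
    by (auto intro!: sym_tensor_field_mset_cong[OF sym] simp: idx_lists_def)
  have "T is z = symprod_list ?F is z" if "is \<in> idx_lists 3" for "is" z
  proof -
    obtain a b c where abc: "is = [a, b, c]" "a = 0 \<or> a = 1" "b = 0 \<or> b = 1" "c = 0 \<or> c = 1"
      using \<open>is \<in> idx_lists 3\<close> by (auto simp: idx_lists_cases)
    show ?thesis
      unfolding symprod_metric_constant_vector_field[OF that] unfolding abc(1) using abc(2-4)
      by (elim disjE) (simp_all add: eqs T metric_tensor_def constant_vector_field_def power2_eq_square)
  qed
  moreover have "killing \<omega>1 \<omega>2 \<mu> 2 (metric_tensor \<mu>)" "killing \<omega>1 \<omega>2 \<mu> 1 (constant_vector_field \<mu> w0 w1)"
    using killing_metric_tensor[OF \<mu>] killing_constant_vector_field[OF \<mu> div] by simp_all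
  ultimately show ?thesis
    unfolding reducible_killing_def by (intro exI[of _ "Suc 0"] exI[of _ "\<lambda>_. ?F"]) (simp add: lessThan_Suc)
qed

subsection \<open>The curvature identity\<close>

text \<open>Integrability condition of the overdetermined system for \<open>u\<close>. The equations
  are assumed between functions because the proof differentiates them twice.\<close>

lemma curvature_identity:
  fixes a1 a2 :: real
  assumes \<mu> [simp]: "smooth2 \<mu>" and u [simp]: "smooth2 u1" "smooth2 u2"
    and L: "L = (\<lambda>z. exp (2 * \<mu> z))"
    and S: "(\<lambda>z. pd 0 u1 z - pd 1 u2 z) = (\<lambda>z. - (a1 * pd 0 L z + a2 * pd 1 L z))"
    and T: "(\<lambda>z. pd 0 u2 z + pd 1 u1 z) = (\<lambda>z. a1 * pd 1 L z - a2 * pd 0 L z)"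
    and D: "(\<lambda>z. pd 0 (\<lambda>z. L z * u1 z) z + pd 1 (\<lambda>z. L z * u2 z) z) = (\<lambda>z. 0)"
  shows "a1 * Lambda1 \<mu> z + a2 * Lambda2 \<mu> z =
    - (u1 z * pd 0 (gauss_curv \<mu>) z + u2 z * pd 1 (gauss_curv \<mu>) z)"
proof -
  \<comment> \<open>Mixed derivatives are normalised with \<open>pd 0\<close> outermost, so that
    equal ones become the same term for \<open>algebra\<close>.\<close>
  note [simp] = pd_commute
  have [simp]: "smooth2 L"
    by (simp add: L)
  have Lx [simp]: "pd i L = (\<lambda>z. 2 * L z * pd i \<mu> z)" if "i \<in> {0, 1}" for i
    using that by (auto simp: L fun_eq_iff)
  have L0: "L z \<noteq> 0" for z
    by (simp add: L)
  have D': "(\<lambda>z. pd 0 u1 z + pd 1 u2 z) = (\<lambda>z. - 2 * (u1 z * pd 0 \<mu> z + u2 z * pd 1 \<mu> z))"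
  proof
    fix z
    have "L z * (pd 0 u1 z + pd 1 u2 z + 2 * (u1 z * pd 0 \<mu> z + u2 z * pd 1 \<mu> z)) = 0"
      using fun_cong[OF D, of z] by (simp add: algebra_simps)
    then show "pd 0 u1 z + pd 1 u2 z = - 2 * (u1 z * pd 0 \<mu> z + u2 z * pd 1 \<mu> z)"
      using L0[of z] by simp
  qed
  have s: "pd 0 u1 z - pd 1 u2 z = - 2 * L z * (a1 * pd 0 \<mu> z + a2 * pd 1 \<mu> z)"
    using fun_cong[OF S, of z] by (simp add: algebra_simps)
  have t: "pd 0 u2 z + pd 1 u1 z = 2 * L z * (a1 * pd 1 \<mu> z - a2 * pd 0 \<mu> z)"
    using fun_cong[OF T, of z] by (simp add: algebra_simps)
  note d = fun_cong[OF D', of z]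
  have Sx: "pd 0 (\<lambda>z. pd 0 u1 z - pd 1 u2 z) z = pd 0 (\<lambda>z. - (a1 * pd 0 L z + a2 * pd 1 L z)) z"
    and Sy: "pd 1 (\<lambda>z. pd 0 u1 z - pd 1 u2 z) z = pd 1 (\<lambda>z. - (a1 * pd 0 L z + a2 * pd 1 L z)) z"
    and Tx: "pd 0 (\<lambda>z. pd 0 u2 z + pd 1 u1 z) z = pd 0 (\<lambda>z. a1 * pd 1 L z - a2 * pd 0 L z) z"
    and Ty: "pd 1 (\<lambda>z. pd 0 u2 z + pd 1 u1 z) z = pd 1 (\<lambda>z. a1 * pd 1 L z - a2 * pd 0 L z) z"
    and Sxx: "pd 0 (pd 0 (\<lambda>z. pd 0 u1 z - pd 1 u2 z)) z = pd 0 (pd 0 (\<lambda>z. - (a1 * pd 0 L z + a2 * pd 1 L z))) z"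
    and Syy: "pd 1 (pd 1 (\<lambda>z. pd 0 u1 z - pd 1 u2 z)) z = pd 1 (pd 1 (\<lambda>z. - (a1 * pd 0 L z + a2 * pd 1 L z))) z"
    and Txy: "pd 0 (pd 1 (\<lambda>z. pd 0 u2 z + pd 1 u1 z)) z = pd 0 (pd 1 (\<lambda>z. a1 * pd 1 L z - a2 * pd 0 L z)) z"
    and Dxx: "pd 0 (pd 0 (\<lambda>z. pd 0 u1 z + pd 1 u2 z)) z = pd 0 (pd 0 (\<lambda>z. - 2 * (u1 z * pd 0 \<mu> z + u2 z * pd 1 \<mu> z))) z"
    and Dyy: "pd 1 (pd 1 (\<lambda>z. pd 0 u1 z + pd 1 u2 z)) z = pd 1 (pd 1 (\<lambda>z. - 2 * (u1 z * pd 0 \<mu> z + u2 z * pd 1 \<mu> z))) z"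
    by (simp_all only: S T D')
  \<comment> \<open>With \<open>D\<close>, \<open>S\<close>, \<open>T\<close> the left-hand sides above, the Laplacian of \<open>D\<close> is \<open>S\<^sub>x\<^sub>x - S\<^sub>y\<^sub>y + 2 T\<^sub>x\<^sub>y\<close>, and those of
    \<open>u1\<close>, \<open>u2\<close> are \<open>S\<^sub>x + T\<^sub>y\<close>, \<open>T\<^sub>x - S\<^sub>y\<close>; this eliminates every second and third derivative of \<open>u\<close>.\<close>
  define M where "M = (\<lambda>i. pd i (\<lambda>z. pd 0 (pd 0 \<mu>) z + pd 1 (pd 1 \<mu>) z) z
    - 2 * pd i \<mu> z * (pd 0 (pd 0 \<mu>) z + pd 1 (pd 1 \<mu>) z))"
  \<comment> \<open>What remains of the first derivatives of \<open>u\<close> are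
    \<open>pd 0 u1\<close>, \<open>pd 1 u2\<close> and the sum \<open>pd 0 u2 + pd 1 u1\<close>, all
    determined by \<open>s\<close>, \<open>t\<close> and \<open>d\<close>.\<close>
  have "L z * (a1 * Lambda1 \<mu> z + a2 * Lambda2 \<mu> z) =
    u1 z * M 0 + u2 z * M 1"
    using Sx Sy Tx Ty Sxx Syy Txy Dxx Dyy s t d
    by (simp add: M_def Lambda1_def Lambda2_def) algebra
  then have "a1 * Lambda1 \<mu> z + a2 * Lambda2 \<mu> z = (u1 z * M 0 + u2 z * M 1) / L z"
    using L0[of z] by (simp add: M_def eq_divide_eq mult.commute)
  \<comment> \<open>Product rule for \<open>- (\<mu>_xx + \<mu>_yy) / L\<close>: the factor
    \<open>1 / L\<close> contributes the second term of \<open>M\<close>.\<close>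
  moreover have "pd i (gauss_curv \<mu>) z = - M i / L z" if "i \<in> {0, 1}" for i
    using that unfolding gauss_curv_def[abs_def]
    by (elim insertE emptyE; hypsubst; simp) (simp_all add: M_def L exp_minus field_simps)
  ultimately show ?thesis
    by (simp add: algebra_simps add_divide_distrib)
qed

section \<open>Velocity along isolines, and the case of vanishing cubic part\<close>

lemma smooth2_gauss_curv: "smooth2 \<mu> \<Longrightarrow> smooth2 (gauss_curv \<mu>)"
  unfolding gauss_curv_def[abs_def] by simp

text \<open>Orthogonality leaves a multiple \<open>s\<close> of the rotated vector
  \<open>(- q, p)\<close>; \<open>pos\<close> makes \<open>s\<close> positive, and comparing lengths
  gives \<open>s = e\<close>.\<close>

lemma orthogonal_vector_eq:
  fixes p q x y e :: real
  assumes orth: "p * x + q * y = 0" and nz: "(p, q) \<noteq> (0, 0)" and e: "e \<ge> 0"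
    and len: "sqrt (x\<^sup>2 + y\<^sup>2) = e * sqrt (p\<^sup>2 + q\<^sup>2)" and pos: "p * y - q * x > 0"
  shows "x = - e * q" "y = e * p"
proof -
  define N s where "N = p\<^sup>2 + q\<^sup>2" and "s = (p * y - q * x) / N"
  have N: "N > 0"
    using nz by (auto simp: N_def sum_power2_gt_zero_iff)
  then have s: "s > 0"
    using pos by (simp add: s_def)
  have "N * x = - (p * y - q * x) * q" "N * y = (p * y - q * x) * p"
    using orth unfolding N_def by algebra+
  then have xy: "x = - s * q" "y = s * p"
    using N by (simp_all add: s_def field_simps)
  have "x\<^sup>2 + y\<^sup>2 = s\<^sup>2 * N"
    by (simp add: xy N_def algebra_simps)
  then have "s * sqrt N = e * sqrt N"
    using len s by (simp add: real_sqrt_mult N_def)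
  then have "s = e"
    using N by simp
  with xy show "x = - e * q" "y = e * p"
    by simp_all
qed

lemma has_vector_derivative_compose:
  fixes f :: "complex \<Rightarrow> real"
  assumes "(f has_derivative (\<lambda>h. A * Re h + B * Im h)) (at (\<gamma> t))"
    and "(\<gamma> has_vector_derivative v) (at t within S)"
  shows "((\<lambda>t. f (\<gamma> t)) has_vector_derivative A * Re v + B * Im v) (at t within S)"
  using has_derivative_compose[OF assms(2)[unfolded has_vector_derivative_def] assms(1)]
  unfolding has_vector_derivative_def
  by (auto simp: algebra_simps elim!: has_derivative_eq_rhs)

text \<open>By \<open>CR\<close> the functions \<open>u1\<close> and \<open>u2\<close> are constant.
  By \<open>a\<close> they determine \<open>T\<close>, which becomes a product of the metric with a
  constant field; \<open>div\<close> makes that field Killing.\<close>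

lemma reducible_killing_3_if_cubic_part_zero:
  assumes basis: "is_lattice_basis \<omega>1 \<omega>2" and \<mu>: "smooth2 \<mu>" "periodic \<omega>1 \<omega>2 \<mu>"
    and T: "sym_tensor_field \<omega>1 \<omega>2 3 T"
    and u: "smooth2 u1" "smooth2 u2" "periodic \<omega>1 \<omega>2 u1" "periodic \<omega>1 \<omega>2 u2"
    and u1: "\<And>z. u1 z = exp (- 2 * \<mu> z) ^ 2 * (T [0, 0, 0] z + T [0, 1, 1] z)"
    and u2: "\<And>z. u2 z = exp (- 2 * \<mu> z) ^ 2 * (T [0, 0, 1] z + T [1, 1, 1] z)"
    and CR: "\<And>z. pd 0 u1 z = pd 1 u2 z" "\<And>z. pd 1 u1 z = - pd 0 u2 z"
    and div: "\<And>z. pd 0 (\<lambda>z. exp (2 * \<mu> z) * u1 z) z + pd 1 (\<lambda>z. exp (2 * \<mu> z) * u2 z) z = 0"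
    and a: "\<And>z. T [0, 0, 0] z = 3 * T [0, 1, 1] z" "\<And>z. T [1, 1, 1] z = 3 * T [0, 0, 1] z"
  shows "reducible_killing \<omega>1 \<omega>2 \<mu> 3 T"
proof -
  obtain d1 d2 where d: "u1 = (\<lambda>z. d1)" "u2 = (\<lambda>z. d2)"
    using periodic_Cauchy_Riemann_constant[OF basis u(1,3,2,4) CR] .
  have LE: "exp (2 * \<mu> z) ^ 2 * exp (- 2 * \<mu> z) ^ 2 = 1" for z
    by (simp add: power_mult_distrib[symmetric] exp_minus)
  have T': "T [0, 1, 1] z = exp (2 * \<mu> z) ^ 2 * (d1 / 4)" "T [0, 0, 1] z = exp (2 * \<mu> z) ^ 2 * (d2 / 4)" for z
    using u1[of z] u2[of z] LE[of z] unfolding d a by algebra+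
  \<comment> \<open>By \<open>a\<close>, the sum in \<open>u1\<close> is four times
    \<open>T [0, 1, 1]\<close>, while \<open>T [0, 0, 0]\<close> is three times it; hence the factor
    3/4, and likewise for \<open>u2\<close>.\<close>
  show ?thesis
  proof (rule reducible_killing_3[OF \<mu> _ T, where ?w0.0 = "3 * d1 / 4" and ?w1.0 = "3 * d2 / 4"])
    fix z
    have "exp (2 * \<mu> z) * (d1 * pd 0 \<mu> z + d2 * pd 1 \<mu> z) = 0"
      using div[of z] \<mu>(1) by (simp add: d algebra_simps)
    then show "3 * d1 / 4 * pd 0 \<mu> z + 3 * d2 / 4 * pd 1 \<mu> z = 0"
      by simp
  qed (simp_all add: a T')
qed

text \<open>The pair \<open>(c1, c2)\<close> represents the pseudovector in the given coordinates. A
  class in the first cohomology of the torus has a unique constant representative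
  \<open>\<alpha> dx + \<beta> dy\<close>, and a closed curve with lift \<open>\<gamma>\<close> has
  as homology class the lattice vector \<open>\<gamma> b - \<gamma> a\<close>; the right-hand side
  is their pairing. The strict inequality fixes the direction of travel.\<close>

theorem theorem4p2:
  fixes \<omega>1 \<omega>2 :: complex and \<mu> :: "complex \<Rightarrow> real"
  assumes "is_lattice_basis \<omega>1 \<omega>2"
    and "smooth2 \<mu>" and "periodic \<omega>1 \<omega>2 \<mu>"
    and "\<exists>f. irreducible_killing \<omega>1 \<omega>2 \<mu> 3 f"
  shows "\<exists>c1 c2 \<alpha> \<beta> :: real. (c1, c2) \<noteq> (0, 0) \<and>
    (\<forall>(\<gamma> :: real \<Rightarrow> complex) \<gamma>' a b K0.
       a < b \<and> continuous_on {a..b} \<gamma>' \<and>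
       (\<forall>t\<in>{a..b}. (\<gamma> has_vector_derivative \<gamma>' t) (at t within {a..b})) \<and>
       \<gamma> b - \<gamma> a \<in> lattice \<omega>1 \<omega>2 \<and>
       (\<forall>t\<in>{a..b}.
          gauss_curv \<mu> (\<gamma> t) = K0 \<and>
          (pd 0 (gauss_curv \<mu>) (\<gamma> t), pd 1 (gauss_curv \<mu>) (\<gamma> t)) \<noteq> (0, 0) \<and>
          exp (\<mu> (\<gamma> t)) * norm (\<gamma>' t) =
            exp (- \<mu> (\<gamma> t)) * sqrt ((pd 0 (gauss_curv \<mu>) (\<gamma> t))\<^sup>2 + (pd 1 (gauss_curv \<mu>) (\<gamma> t))\<^sup>2) \<and>
          pd 0 (gauss_curv \<mu>) (\<gamma> t) * Im (\<gamma>' t) - pd 1 (gauss_curv \<mu>) (\<gamma> t) * Re (\<gamma>' t) > 0)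
     \<longrightarrow> integral {a..b} (\<lambda>t. c1 * Lambda1 \<mu> (\<gamma> t) + c2 * Lambda2 \<mu> (\<gamma> t))
         = \<alpha> * Re (\<gamma> b - \<gamma> a) + \<beta> * Im (\<gamma> b - \<gamma> a))"
proof -
  note basis = assms(1) and \<mu> = assms(2,3)
  obtain T where kill: "killing \<omega>1 \<omega>2 \<mu> 3 T" and irred: "\<not> reducible_killing \<omega>1 \<omega>2 \<mu> 3 T"
    using assms(4) by (auto simp: irreducible_killing_def)
  have sym: "sym_tensor_field \<omega>1 \<omega>2 3 T"
    using kill by (simp add: killing_def)
  have T: "smooth2 (T [i, j, k])" "periodic \<omega>1 \<omega>2 (T [i, j, k])" if "{i, j, k} \<subseteq> {0, 1}" for i j k
    using sym that by (auto simp: sym_tensor_field_def idx_lists_def)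
  define E where "E = (\<lambda>z. exp (- 2 * \<mu> z))"
  define L where "L = (\<lambda>z. exp (2 * \<mu> z))"
  \<comment> \<open>Raising three indices costs \<open>E ^ 3\<close>; \<open>u\<close> carries one
    more factor \<open>L\<close>, hence \<open>E ^ 2\<close> there.\<close>
  define a1 where "a1 = (\<lambda>z. E z ^ 3 * (T [0, 0, 0] z - 3 * T [0, 1, 1] z))"
  define a2 where "a2 = (\<lambda>z. E z ^ 3 * (3 * T [0, 0, 1] z - T [1, 1, 1] z))"
  define u1 where "u1 = (\<lambda>z. E z ^ 2 * (T [0, 0, 0] z + T [0, 1, 1] z))"
  define u2 where "u2 = (\<lambda>z. E z ^ 2 * (T [0, 0, 1] z + T [1, 1, 1] z))"
  note sys = killing_3_reduced_system[OF kill \<mu>(1) E_def L_def a1_def a2_def u1_def u2_def]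
  have E: "smooth2 E" "smooth2 L" "periodic \<omega>1 \<omega>2 E" "periodic \<omega>1 \<omega>2 L"
    using \<mu> by (simp_all add: E_def L_def periodic_def)
  have smooth: "smooth2 a1" "smooth2 a2" "smooth2 u1" "smooth2 u2"
    unfolding a1_def a2_def u1_def u2_def by (simp_all add: E T)
  have per: "periodic \<omega>1 \<omega>2 a1" "periodic \<omega>1 \<omega>2 a2" "periodic \<omega>1 \<omega>2 u1" "periodic \<omega>1 \<omega>2 u2"
    using E(3) T(2)[of 0 0 0] T(2)[of 0 0 1] T(2)[of 0 1 1] T(2)[of 1 1 1]
    by (simp_all add: periodic_def a1_def a2_def u1_def u2_def)
  obtain c1 c2 where c: "a1 = (\<lambda>z. c1)" "a2 = (\<lambda>z. c2)"
    using periodic_Cauchy_Riemann_constant[OF basis smooth(1) per(1) smooth(2) per(2) sys(1,2)] .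
  note sys = sys(3-5)[unfolded c]
  \<comment> \<open>Irreducibility enters here: a vanishing pair would make \<open>T\<close> a
    product of the metric and a Killing vector field.\<close>
  have nz: "(c1, c2) \<noteq> (0, 0)"
  proof
    assume "(c1, c2) = (0, 0)"
    then have c0: "c1 = 0" "c2 = 0"
      by simp_all
    have "E z \<noteq> 0" for z
      by (simp add: E_def)
    then have a: "T [0, 0, 0] z = 3 * T [0, 1, 1] z" "T [1, 1, 1] z = 3 * T [0, 0, 1] z" for z
      using fun_cong[OF c(1), of z] fun_cong[OF c(2), of z] by (simp_all add: a1_def a2_def c0)
    have "reducible_killing \<omega>1 \<omega>2 \<mu> 3 T"
    proof (rule reducible_killing_3_if_cubic_part_zero[OF basis \<mu> sym smooth(3,4) per(3,4) _ _ _ _ _ a])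
      fix z
      show "pd 0 u1 z = pd 1 u2 z" "pd 1 u1 z = - pd 0 u2 z"
        using sys(1)[of z] sys(2)[of z] by (simp_all add: c0)
      show "pd 0 (\<lambda>z. exp (2 * \<mu> z) * u1 z) z + pd 1 (\<lambda>z. exp (2 * \<mu> z) * u2 z) z = 0"
        using sys(3)[of z] by (simp add: L_def)
    qed (simp_all add: u1_def u2_def E_def)
    with irred show False ..
  qed
  have Lambda: "c1 * Lambda1 \<mu> z + c2 * Lambda2 \<mu> z =
    - (u1 z * pd 0 (gauss_curv \<mu>) z + u2 z * pd 1 (gauss_curv \<mu>) z)" for z
    by (rule curvature_identity[OF \<mu>(1) smooth(3,4) L_def]) (simp_all add: sys)
  \<comment> \<open>Closedness of \<open>L * (u2 dx - u1 dy)\<close> is the divergence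
    equation.\<close>
  define P Q where "P = (\<lambda>z. L z * u2 z)" and "Q = (\<lambda>z. - (L z * u1 z))"
  have PQ: "smooth2 P" "smooth2 Q" "periodic \<omega>1 \<omega>2 P" "periodic \<omega>1 \<omega>2 Q"
    using E per by (simp_all add: P_def Q_def smooth periodic_def)
  have "pd 1 P = pd 0 Q"
  proof
    show "pd 1 P z = pd 0 Q z" for z
      using sys(3)[of z] E smooth by (simp add: P_def Q_def algebra_simps)
  qed
  then obtain \<phi> where \<phi>: "\<And>z. (\<phi> has_derivative (\<lambda>h. P z * Re h + Q z * Im h)) (at z)"
    using closed_form_potential[OF PQ(1,2)] by blast
  obtain \<alpha> \<beta> where periods:
    "\<And>z w. w - z \<in> lattice \<omega>1 \<omega>2 \<Longrightarrow> \<phi> w - \<phi> z = \<alpha> * Re (w - z) + \<beta> * Im (w - z)"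
    using periodic_form_potential_periods[OF basis \<phi> PQ(3,4)] by blast
  let ?K = "gauss_curv \<mu>"
  have "integral {a..b} (\<lambda>t. c1 * Lambda1 \<mu> (\<gamma> t) + c2 * Lambda2 \<mu> (\<gamma> t)) =
      \<alpha> * Re (\<gamma> b - \<gamma> a) + \<beta> * Im (\<gamma> b - \<gamma> a)"
    if ab: "a < b"
      and \<gamma>: "\<forall>t\<in>{a..b}. (\<gamma> has_vector_derivative \<gamma>' t) (at t within {a..b})"
      and closed: "\<gamma> b - \<gamma> a \<in> lattice \<omega>1 \<omega>2"
      and iso: "\<forall>t\<in>{a..b}.
          ?K (\<gamma> t) = K0 \<and>
          (pd 0 ?K (\<gamma> t), pd 1 ?K (\<gamma> t)) \<noteq> (0, 0) \<and>
          exp (\<mu> (\<gamma> t)) * norm (\<gamma>' t) =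
            exp (- \<mu> (\<gamma> t)) * sqrt ((pd 0 ?K (\<gamma> t))\<^sup>2 + (pd 1 ?K (\<gamma> t))\<^sup>2) \<and>
          pd 0 ?K (\<gamma> t) * Im (\<gamma>' t) - pd 1 ?K (\<gamma> t) * Re (\<gamma>' t) > 0"
    for \<gamma> \<gamma>' a b K0
  proof -
    have "((\<lambda>t. \<phi> (\<gamma> t)) has_vector_derivative c1 * Lambda1 \<mu> (\<gamma> t) + c2 * Lambda2 \<mu> (\<gamma> t)) (at t within {a..b})"
      if t: "t \<in> {a..b}" for t
    proof -
      note iso_t = bspec[OF iso t]
      have K0: "?K (\<gamma> s) = K0" if "s \<in> {a..b}" for s
        using iso that by blast
      \<comment> \<open>The chain rule is compared with the constancy of the curvature along the
        curve, so the velocity is orthogonal to the gradient.\<close>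
      have "((\<lambda>t. ?K (\<gamma> t)) has_vector_derivative pd 0 ?K (\<gamma> t) * Re (\<gamma>' t) + pd 1 ?K (\<gamma> t) * Im (\<gamma>' t))
          (at t within {a..b})"
        by (intro has_vector_derivative_compose smooth2_has_derivative smooth2_gauss_curv \<mu> bspec[OF \<gamma> t])
      moreover have "((\<lambda>t. ?K (\<gamma> t)) has_vector_derivative 0) (at t within {a..b})"
        by (rule has_vector_derivative_transform[OF t K0 has_vector_derivative_const])
      ultimately have orth: "pd 0 ?K (\<gamma> t) * Re (\<gamma>' t) + pd 1 ?K (\<gamma> t) * Im (\<gamma>' t) = 0"
        using vector_derivative_unique_within_closed_interval[OF ab] t by auto
      \<comment> \<open>Riemannian lengths become Euclidean: the speed has weight
        \<open>exp \<mu>\<close>, the gradient \<open>exp (- \<mu>)\<close>, and the quotient is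
        \<open>E\<close>.\<close>
      have "norm (\<gamma>' t) = exp (- \<mu> (\<gamma> t)) * (exp (\<mu> (\<gamma> t)) * norm (\<gamma>' t))"
        by (simp add: exp_minus)
      also have "\<dots> = E (\<gamma> t) * sqrt ((pd 0 ?K (\<gamma> t))\<^sup>2 + (pd 1 ?K (\<gamma> t))\<^sup>2)"
        unfolding iso_t[THEN conjunct2, THEN conjunct2, THEN conjunct1] by (simp add: E_def mult_exp_exp mult.assoc[symmetric])
      finally have "sqrt ((Re (\<gamma>' t))\<^sup>2 + (Im (\<gamma>' t))\<^sup>2) =
          E (\<gamma> t) * sqrt ((pd 0 ?K (\<gamma> t))\<^sup>2 + (pd 1 ?K (\<gamma> t))\<^sup>2)"
        by (simp add: cmod_def)
      from orthogonal_vector_eq[OF orth _ _ this]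
      have \<gamma>'_eq: "Re (\<gamma>' t) = - E (\<gamma> t) * pd 1 ?K (\<gamma> t)" "Im (\<gamma>' t) = E (\<gamma> t) * pd 0 ?K (\<gamma> t)"
        using iso_t by (simp_all add: E_def)
      \<comment> \<open>The conformal factors of the form and of the velocity cancel, which leaves
        \<open>- (u1 K_x + u2 K_y)\<close>.\<close>
      have "L (\<gamma> t) * E (\<gamma> t) = 1"
        by (simp add: L_def E_def exp_minus)
      then have "P (\<gamma> t) * Re (\<gamma>' t) + Q (\<gamma> t) * Im (\<gamma>' t) =
          c1 * Lambda1 \<mu> (\<gamma> t) + c2 * Lambda2 \<mu> (\<gamma> t)"
        unfolding Lambda \<gamma>'_eq P_def Q_def by algebra
      then show ?thesis
        using has_vector_derivative_compose[where \<gamma> = \<gamma> and t = t, OF \<phi> bspec[OF \<gamma> t]] by simp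
    qed
    \<comment> \<open>The integrand is the derivative of \<open>\<phi>\<close> along the curve, so
      its integral is a period of the form.\<close>
    then have "integral {a..b} (\<lambda>t. c1 * Lambda1 \<mu> (\<gamma> t) + c2 * Lambda2 \<mu> (\<gamma> t)) = \<phi> (\<gamma> b) - \<phi> (\<gamma> a)"
      using ab by (intro integral_unique fundamental_theorem_of_calculus) auto
    also have "\<dots> = \<alpha> * Re (\<gamma> b - \<gamma> a) + \<beta> * Im (\<gamma> b - \<gamma> a)"
      using periods[OF closed] .
    finally show ?thesis .
  qed
  note main = this
  show ?thesis
    by (intro exI[of _ c1] exI[of _ c2] exI[of _ \<alpha>] exI[of _ \<beta>] conjI[OF nz] allI impI, elim conjE)
      (rule main)
qed

end
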